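(* Let $m\in M_0$. Let $n\in\mathbb N$ be coprime to $m$ and to $|L(\mathcal S)|$. Let $N=nm$. Then $$\mathcal G/\mathcal T^N=(\mathcal T^m/\mathcal T^N)\rtimes(\mathcal T^n\mathcal F\mathcal P^{(n)}/\mathcal T^N)$$ (internal semidirect product with normal factor $\mathcal T^m/\mathcal T^N$), and $\mathcal T^m/\mathcal T^N$ is isomorphic to $(\mathbb Z/n\mathbb Z)^{d_2}$.
   Context: $\mathbb N=\{1,2,\dots\}$. $E(d)=O(d)\ltimes\mathbb R^d$ is the Euclidean group: elements $(A,b)$ with product $(A_1,b_1)(A_2,b_2)=(A_1A_2,b_1+A_1b_2)$; write $L(A,b)=A$, $\tau(A,b)=b$. A translation is an element $(I_d,b)$. A $d$-dimensional space group is a discrete subgroup of $E(d)$ containing $d$ translations with linearly independent translation vectors. For $A_1\in O(d_1)$ and $(A_2,b_2)\in E(d_2)$ put $A_1\oplus(A_2,b_2):=\left(\begin{pmatrix}A_1&0\\ 0&A_2\end{pmatrix},\begin{pmatrix}0\\ b_2\end{pmatrix}\right)\in E(d_1+d_2)$. Setting: $d\in\mathbb N$, $d_1,d_2\in\mathbb N_0$ with $d=d_1+d_2$; $\mathcal S$ is a $d_2$-dimensional space group; $\mathcal G$ is a discrete subgroup of $O(d_1)\oplus\mathcal S=\{A\oplus g: A\in O(d_1),g\in\mathcal S\}$ (understood as $O(d)$ if $d_1=d$ and as $\mathcal S$ if $d_1=0$) such that $\pi(\mathcal G)=\mathcal S$, where $\pi(A\oplus g)=g$. $\mathcal F=\ker(\pi|_{\mathcal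 G})$; $\mathcal T_{\mathcal S}$ is the group of translations of $\mathcal S$. $\mathcal T\subset\mathcal G$ is a fixed subset such that $\pi|_{\mathcal T}:\mathcal T\to\mathcal T_{\mathcal S}$ is bijective ($\mathcal T$ need not be a group). For a subset $X$ of a group and $n\in\mathbb Z$, $X^n:=\{x^n:x\in X\}$; $XY$ denotes the product set. $M_0:=\{m\in\mathbb N:\mathcal T^m\text{ is a normal subgroup of }\mathcal G\}$ (which is of the form $m_0\mathbb N$). The point group $L(\mathcal S)$ is finite. Fix a map $\tilde\tau:L(\mathcal S)\to\tau(\mathcal S)$ with $(P,\tilde\tau(P))\in\mathcal S$ for all $P\in L(\mathcal S)$, and let $\bar\tau:L(\mathcal S)\times L(\mathcal S)\to\tau(\mathcal T_{\mathcal S})$, $\bar\tau(P,Q)=\tilde\tau(P)+P\tilde\tau(Q)-\tilde\tau(PQ)$. For $n\in\mathbb N$ coprime to $|L(\mathcal S)|$ let $a(n)=\max\{\tilde a\in\{0,-1,-2,\dots\}:\exists b\in\mathbb Z\text{ with }\tilde a|L(\mathcal S)|+bn=1\}$ and $$\mathcal P_{\mathcal S}^{(n)}:=\Bigl\{\Bigl(P,\ \tilde\tau(P)-a(n)\sum_{Q\in L(\mathcal S)}\bar\tau(P,Q)\Bigr):P\in L(\mathcal S)\Bigr\}\subset\mathcal S,$$ and let $\mathcal P^{(n)}\subset\mathcal G$ be a fixed subset such that $\pi|_{\mathcal P^{(n)}}:\mathcal P^{(n)}\to\mathcal P_{\mathcal S}^{(n)}$ is bijective. ($\mathcal T^n\mathcal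 F\mathcal P^{(n)}$ is a subgroup of $\mathcal G$ containing $\mathcal T^N$ as a normal subgroup for all $N\in n\mathbb N\cap M_0$.) *)

theory Defs
  imports
    "HOL-Algebra.Product_Groups"
    "HOL-Algebra.Elementary_Groups"
    "Jordan_Normal_Form.VS_Connect"
begin

text \<open>
  Real matrices and vectors carry their dimension in an explicit carrier, so that all dimensions
  (including 0) are ordinary natural numbers.
\<close>

definition orthogonal_group :: "nat \<Rightarrow> real mat set" where
  "orthogonal_group d = {A \<in> carrier_mat d d. transpose_mat A * A = 1\<^sub>m d}"

type_synonym isometry = "real mat \<times> real vec"

definition euclidean_group :: "nat \<Rightarrow> isometry monoid" where
  "euclidean_group d =
    \<lparr>carrier = orthogonal_group d \<times> carrier_vec d,
     monoid.mult = (\<lambda>(A1, b1) (A2, b2). (A1 * A2, b1 + A1 *\<^sub>v b2)),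
     one = (1\<^sub>m d, 0\<^sub>v d)\<rparr>"

abbreviation eucl_sub :: "nat \<Rightarrow> isometry set \<Rightarrow> isometry monoid" where
  "eucl_sub d X \<equiv> (euclidean_group d)\<lparr>carrier := X\<rparr>"

abbreviation linear_part :: "isometry \<Rightarrow> real mat" where
  "linear_part g \<equiv> fst g"

abbreviation transl_part :: "isometry \<Rightarrow> real vec" where
  "transl_part g \<equiv> snd g"

text \<open>
  \<open>eucl_dist d\<close> is the distance of \<open>\<real>\<^bsup>d\<times>d\<^esup> \<times> \<real>\<^bsup>d\<^esup>\<close>, which induces the usual topology of the
  Euclidean group; \<open>discrete_in\<close> says that the subspace topology on \<open>X\<close> is discrete.
\<close>

definition eucl_dist :: "nat \<Rightarrow> isometry \<Rightarrow> isometry \<Rightarrow> real" where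
  "eucl_dist d g h =
    sqrt ((\<Sum>i<d. \<Sum>j<d. (linear_part g $$ (i, j) - linear_part h $$ (i, j))\<^sup>2)
        + (\<Sum>i<d. (transl_part g $ i - transl_part h $ i)\<^sup>2))"

definition discrete_in :: "nat \<Rightarrow> isometry set \<Rightarrow> bool" where
  "discrete_in d X \<longleftrightarrow> (\<forall>g\<in>X. \<exists>\<epsilon>>0. \<forall>h\<in>X. eucl_dist d g h < \<epsilon> \<longrightarrow> h = g)"

definition translation_group :: "nat \<Rightarrow> isometry set \<Rightarrow> isometry set" where
  "translation_group d S = {g \<in> S. linear_part g = 1\<^sub>m d}"

definition space_group :: "nat \<Rightarrow> isometry set \<Rightarrow> bool" where
  "space_group d S \<longleftrightarrow>
     subgroup S (euclidean_group d) \<and> discrete_in d S \<and>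
     (\<exists>B. B \<subseteq> transl_part ` translation_group d S \<and> finite B \<and> card B = d \<and>
          \<not> module.lin_dep class_ring (module_vec TYPE(real) d) B)"

definition dsum :: "real mat \<Rightarrow> isometry \<Rightarrow> isometry" where
  "dsum A g =
    (four_block_mat A (0\<^sub>m (dim_row A) (dim_col (linear_part g)))
       (0\<^sub>m (dim_row (linear_part g)) (dim_col A)) (linear_part g),
     0\<^sub>v (dim_row A) @\<^sub>v transl_part g)"

definition orth_dsum :: "nat \<Rightarrow> isometry set \<Rightarrow> isometry set" where
  "orth_dsum d1 S = {dsum A g | A g. A \<in> orthogonal_group d1 \<and> g \<in> S}"

text \<open>
  The projection \<open>A \<oplus> g \<mapsto> g\<close> reads off the lower right block and the last \<open>d2\<close> coordinates.
\<close>

definition proj :: "nat \<Rightarrow> nat \<Rightarrow> isometry \<Rightarrow> isometry" where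
  "proj d1 d2 h =
    (mat d2 d2 (\<lambda>(i, j). linear_part h $$ (d1 + i, d1 + j)),
     vec d2 (\<lambda>i. transl_part h $ (d1 + i)))"

lemma proj_dsum:
  assumes "A \<in> orthogonal_group d1" and "g \<in> carrier (euclidean_group d2)"
  shows "proj d1 d2 (dsum A g) = g"
  using assms
  by (cases g) (auto simp: proj_def dsum_def orthogonal_group_def euclidean_group_def
      intro!: eq_matI eq_vecI)

definition set_pow :: "('a, 'b) monoid_scheme \<Rightarrow> 'a set \<Rightarrow> nat \<Rightarrow> 'a set" where
  "set_pow G X n = (\<lambda>x. x [^]\<^bsub>G\<^esub> n) ` X"

definition M0_set :: "nat \<Rightarrow> isometry set \<Rightarrow> isometry set \<Rightarrow> nat set" where
  "M0_set d G T = {m. m \<ge> 1 \<and> set_pow (euclidean_group d) T m \<lhd> eucl_sub d G}"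

abbreviation point_group :: "isometry set \<Rightarrow> real mat set" where
  "point_group S \<equiv> linear_part ` S"

definition tau_bar :: "(real mat \<Rightarrow> real vec) \<Rightarrow> real mat \<Rightarrow> real mat \<Rightarrow> real vec" where
  "tau_bar \<tau> P Q = \<tau> P + P *\<^sub>v \<tau> Q - \<tau> (P * Q)"

definition a_coeff :: "isometry set \<Rightarrow> nat \<Rightarrow> int" where
  "a_coeff S n =
    (GREATEST a::int. a \<le> 0 \<and> (\<exists>b::int. a * int (card (point_group S)) + b * int n = 1))"

definition P_S :: "nat \<Rightarrow> isometry set \<Rightarrow> (real mat \<Rightarrow> real vec) \<Rightarrow> nat \<Rightarrow> isometry set" where
  "P_S d2 S \<tau> n =
    {(P, \<tau> P - real_of_int (a_coeff S n) \<cdot>\<^sub>v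
            finsum_vec TYPE(real) d2 (\<lambda>Q. tau_bar \<tau> P Q) (point_group S)) | P.
      P \<in> point_group S}"

definition internal_semidirect_product ::
  "('a, 'b) monoid_scheme \<Rightarrow> 'a set \<Rightarrow> 'a set \<Rightarrow> bool" where
  "internal_semidirect_product G N H \<longleftrightarrow>
     N \<lhd> G \<and> subgroup H G \<and> N \<inter> H = {\<one>\<^bsub>G\<^esub>} \<and> N <#>\<^bsub>G\<^esub> H = carrier G"

end

theory Submission
  imports Defs "Jordan_Normal_Form.DL_Rank"
begin

text \<open>
  Since the translation group of \<open>S\<close> is torsion-free and \<open>T\<^sup>m\<close> contains the identity, the projection
  \<open>\<pi>\<close> is injective on \<open>T\<^sup>m\<close>. Hence \<open>T\<^sup>m\<close> is isomorphic to the translation group \<open>A\<close> of \<open>S\<close>, a lattice of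
  rank \<open>d2\<close>, and \<open>T\<^sup>N\<close> consists of the \<open>n\<close>-th powers in \<open>T\<^sup>m\<close>. The set \<open>T\<^sup>n F P\<close> is the full preimage of
  \<open>K = A\<^sup>n P_S\<close> in \<open>G\<close>, so everything reduces to three facts about \<open>K\<close>: it is a subgroup, it meets
  \<open>A\<close> in \<open>A\<^sup>n\<close>, and \<open>A K = S\<close>; coprimality of \<open>m\<close> and \<open>n\<close> then transfers them from \<open>A\<close> to \<open>T\<^sup>m\<close>.
  Summing the cocycle identity of \<open>tau_bar\<close> over the last argument shows that \<open>card (point_group S)\<close>
  times \<open>tau_bar\<close> is a coboundary. Correcting \<open>\<tau>\<close> by \<open>a_coeff\<close> times this coboundary leaves only
  multiples of \<open>n\<close>, which makes \<open>K\<close> a subgroup.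
\<close>

section \<open>Lifting a torsion-free abelian subgroup along a homomorphism\<close>

lemma set_pow_consistent [simp]: "set_pow (G\<lparr>carrier := X\<rparr>) Y n = set_pow G Y n"
  by (simp add: set_pow_def nat_pow_def)

lemma (in monoid) set_pow_mult:
  assumes "X \<subseteq> carrier G"
  shows "set_pow G X (n * m) = set_pow G (set_pow G X m) n"
  using assms by (auto simp: set_pow_def image_image nat_pow_pow mult.commute intro!: image_cong)

lemma (in group) conj_nat_pow:
  assumes "g \<in> carrier G" "x \<in> carrier G"
  shows "g \<otimes> x [^] (k::nat) \<otimes> inv g = (g \<otimes> x \<otimes> inv g) [^] k"
proof (induction k)
  case 0
  then show ?case using assms by simp
next
  case (Suc k)
  have "g \<otimes> x [^] Suc k \<otimes> inv g = (g \<otimes> x [^] k \<otimes> inv g) \<otimes> (g \<otimes> x \<otimes> inv g)"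
    using assms by (simp add: m_assoc inv_solve_left)
  then show ?case using Suc by simp
qed

lemma (in group) subgroup_nat_pow_closed:
  assumes "subgroup A G" "x \<in> A"
  shows "x [^] (k::nat) \<in> A"
  using assms by (induction k) (auto intro: subgroup.one_closed subgroup.m_closed)

text \<open>Commutativity turns \<open>x^k y^k\<close> into \<open>(x y)^k\<close>, which is what
  closure under products needs; inverses and the identity are compatible with powers in any
  group.\<close>

lemma (in group) subgroup_set_pow:
  assumes A: "subgroup A G" and comm: "\<And>x y. x \<in> A \<Longrightarrow> y \<in> A \<Longrightarrow> x \<otimes> y = y \<otimes> x"
  shows "subgroup (set_pow G A k) G"
proof (rule subgroupI)
  note sub = subgroup.mem_carrier[OF A]
  show "set_pow G A k \<subseteq> carrier G" using sub by (auto simp: set_pow_def)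
  show "set_pow G A k \<noteq> {}" using subgroup.one_closed[OF A] by (auto simp: set_pow_def)
  show "inv a \<in> set_pow G A k" if "a \<in> set_pow G A k" for a
    using that sub subgroup.m_inv_closed[OF A]
    by (auto simp: set_pow_def simp flip: nat_pow_inv)
  show "a \<otimes> b \<in> set_pow G A k" if ab: "a \<in> set_pow G A k" "b \<in> set_pow G A k" for a b
  proof -
    obtain x y where "x \<in> A" "y \<in> A" "a = x [^] k" "b = y [^] k"
      using ab by (auto simp: set_pow_def)
    then show ?thesis
      using comm sub subgroup.m_closed[OF A]
      by (auto simp: set_pow_def simp flip: pow_mult_distrib)
  qed
qed

lemma (in group) normal_set_pow:
  assumes A: "A \<lhd> G" and comm: "\<And>x y. x \<in> A \<Longrightarrow> y \<in> A \<Longrightarrow> x \<otimes> y = y \<otimes> x"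
  shows "set_pow G A k \<lhd> G"
proof (rule normal_invI)
  note A' = normal_imp_subgroup[OF A]
  show "subgroup (set_pow G A k) G" by (rule subgroup_set_pow[OF A' comm])
  show "g \<otimes> h \<otimes> inv g \<in> set_pow G A k" if g: "g \<in> carrier G" and h: "h \<in> set_pow G A k" for g h
  proof -
    obtain x where x: "x \<in> A" "h = x [^] k" using h by (auto simp: set_pow_def)
    then show ?thesis
      using g conj_nat_pow[OF g subgroup.mem_carrier[OF A' x(1)]] normal.inv_op_closed2[OF A g x(1)]
      by (auto simp: set_pow_def)
  qed
qed

lemma (in group_hom) subgroup_preimage:
  assumes K: "subgroup K H"
  shows "subgroup {g \<in> carrier G. h g \<in> K} G"
  by (rule G.subgroupI)
    (use subgroup.one_closed[OF K] subgroup.m_closed[OF K] subgroup.m_inv_closed[OF K]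
      in \<open>auto intro: exI[of _ "\<one>"]\<close>)

text \<open>Dividing by exactly the intersection of \<open>L\<close> and \<open>H\<close> makes
  their images meet trivially, and the product of the images is the image of the product. All
  remaining work can thus be done with subsets of \<open>G\<close> instead of cosets.\<close>

lemma (in group) internal_semidirect_product_Mod:
  assumes N: "N \<lhd> G" and L: "L \<lhd> G" and H: "subgroup H G"
    and int: "L \<inter> H = N" and gen: "L <#> H = carrier G"
  shows "internal_semidirect_product (G Mod N)
    (carrier (G\<lparr>carrier := L\<rparr> Mod N)) (carrier (G\<lparr>carrier := H\<rparr> Mod N))"
proof -
  interpret N: normal N G by (rule N)
  note L' = normal_imp_subgroup[OF L]
  note Lc = subgroup.mem_carrier[OF L'] and Hc = subgroup.mem_carrier[OF H]
  have NL: "N \<subseteq> L" and NH: "N \<subseteq> H" using int by auto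
  have cL: "carrier (G\<lparr>carrier := L\<rparr> Mod N) = (\<lambda>x. N #> x) ` L"
    and cH: "carrier (G\<lparr>carrier := H\<rparr> Mod N) = (\<lambda>x. N #> x) ` H"
    by (auto simp: carrier_FactGroup)
  have 1: "carrier (G\<lparr>carrier := L\<rparr> Mod N) \<lhd> G Mod N"
    using normality_factorization[OF N NL L] by (simp add: FactGroup_def)
  have 2: "subgroup (carrier (G\<lparr>carrier := H\<rparr> Mod N)) (G Mod N)"
    using normal_subgroup_factorize[OF N NH H] by (simp add: FactGroup_def)
  have 3: "(\<lambda>x. N #> x) ` L \<inter> (\<lambda>x. N #> x) ` H = {N}"
  proof
    show "(\<lambda>x. N #> x) ` L \<inter> (\<lambda>x. N #> x) ` H \<subseteq> {N}"
    proof clarify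
      fix x y assume x: "x \<in> L" and y: "y \<in> H" and eq: "N #> x = N #> y"
      have "x \<in> N #> y" using rcos_self[OF Lc[OF x] N.subgroup_axioms] eq by simp
      then obtain z where "z \<in> N" "x = z \<otimes> y" by (auto simp: r_coset_def)
      then have "x \<in> H" using NH y subgroup.m_closed[OF H] by auto
      then have "x \<in> N" using int x by auto
      then show "N #> x = N" using coset_join2 N.subgroup_axioms by auto
    qed
    have "N = N #> \<one>" using coset_mult_one N.subset by simp
    moreover have "\<one> \<in> L" "\<one> \<in> H"
      using subgroup.one_closed L' H by auto
    ultimately show "{N} \<subseteq> (\<lambda>x. N #> x) ` L \<inter> (\<lambda>x. N #> x) ` H" by blast
  qed
  have 4: "((\<lambda>x. N #> x) ` L) <#>\<^bsub>G Mod N\<^esub> ((\<lambda>x. N #> x) ` H) = carrier (G Mod N)"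
  proof -
    have "((\<lambda>x. N #> x) ` L) <#>\<^bsub>G Mod N\<^esub> ((\<lambda>x. N #> x) ` H) = (\<lambda>x. N #> x) ` (L <#> H)"
      using set_mult_hom[OF N.r_coset_hom_Mod subgroup.subset[OF L'] subgroup.subset[OF H]] ..
    then show ?thesis using gen by (simp add: carrier_FactGroup)
  qed
  show ?thesis
    using 1 2 3 4 by (simp add: internal_semidirect_product_def cL cH)
qed

text \<open>Isolates the group theory from the geometry. \<open>T\<close> is merely a set of lifts
  of \<open>A\<close>; all algebraic control over it comes from the assumption that its m-th powers
  form a normal subgroup.\<close>

locale torsion_free_lift = group_hom G S \<pi>
  for G (structure) and S (structure) and \<pi> +
  fixes A T :: "_ set" and m n :: nat
  assumes surj: "\<pi> ` carrier G = carrier S"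
    and A: "subgroup A S"
    and A_comm: "\<And>x y. x \<in> A \<Longrightarrow> y \<in> A \<Longrightarrow> x \<otimes>\<^bsub>S\<^esub> y = y \<otimes>\<^bsub>S\<^esub> x"
    and A_torsion_free: "\<And>x (k::nat). x \<in> A \<Longrightarrow> k \<ge> 1 \<Longrightarrow> x [^]\<^bsub>S\<^esub> k = \<one>\<^bsub>S\<^esub> \<Longrightarrow> x = \<one>\<^bsub>S\<^esub>"
    and T_carrier: "T \<subseteq> carrier G"
    and T_bij: "bij_betw \<pi> T A"
    and m_pos: "m \<ge> 1"
    and n_pos: "n \<ge> 1"
    and Tm_normal: "set_pow G T m \<lhd> G"
begin

abbreviation "Tm \<equiv> set_pow G T m"
abbreviation "TN \<equiv> set_pow G T (n * m)"

text \<open>Choosing lifts in \<open>T\<close> need not be multiplicative, but the m-th power of the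
  lift is: this map becomes the isomorphism from \<open>A\<close> onto \<open>Tm\<close>.\<close>

definition rho where "rho a = inv_into T \<pi> a [^] m"

lemma A_carrier: "a \<in> A \<Longrightarrow> a \<in> carrier S"
  using subgroup.mem_carrier[OF A] .

lemma Tm_subgroup: "subgroup Tm G"
  by (rule normal_imp_subgroup[OF Tm_normal])

lemma Tm_carrier: "x \<in> Tm \<Longrightarrow> x \<in> carrier G"
  using subgroup.mem_carrier[OF Tm_subgroup] .

lemma lift_A:
  assumes "a \<in> A" shows "inv_into T \<pi> a \<in> T" "\<pi> (inv_into T \<pi> a) = a"
  using assms T_bij by (auto simp: bij_betw_def inv_into_into f_inv_into_f)

lemma pi_T: "t \<in> T \<Longrightarrow> \<pi> t \<in> A"
  using T_bij by (auto simp: bij_betw_def)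

lemma pi_pow_T: "t \<in> T \<Longrightarrow> \<pi> (t [^] (k::nat)) = \<pi> t [^]\<^bsub>S\<^esub> k"
  using T_carrier by (auto intro: hom_nat_pow)

text \<open>As \<open>Tm\<close> is a subgroup, the identity is itself a power \<open>u^m\<close>
  with \<open>u\<close> in \<open>T\<close>. If \<open>t^m\<close> lies in the kernel,
  torsion-freeness puts both \<open>t\<close> and \<open>u\<close> over the identity of
  \<open>S\<close>, so \<open>t = u\<close> by injectivity on \<open>T\<close>, and
  \<open>t^m = u^m\<close> is trivial.\<close>

lemma Tm_trivial_kernel:
  assumes "x \<in> Tm" "\<pi> x = \<one>\<^bsub>S\<^esub>" shows "x = \<one>"
proof -
  have key: "\<pi> t = \<one>\<^bsub>S\<^esub>" if "t \<in> T" "\<pi> (t [^] m) = \<one>\<^bsub>S\<^esub>" for t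
    using that pi_pow_T[of t m] A_torsion_free[OF pi_T m_pos] by auto
  obtain t where t: "t \<in> T" "x = t [^] m" using assms(1) by (auto simp: set_pow_def)
  obtain u where u: "u \<in> T" "\<one> = u [^] m"
    using subgroup.one_closed[OF Tm_subgroup] by (auto simp: set_pow_def)
  have "\<pi> t = \<pi> u" using key[of t] key[of u] t u assms(2) hom_one by metis
  then have "t = u" using t(1) u(1) T_bij by (auto simp: bij_betw_def dest: inj_onD)
  then show ?thesis using t u by simp
qed

lemma inj_on_Tm: "inj_on \<pi> Tm"
proof (rule inj_onI)
  fix x y assume x: "x \<in> Tm" and y: "y \<in> Tm" and eq: "\<pi> x = \<pi> y"
  have c: "x \<in> carrier G" "y \<in> carrier G" using x y Tm_carrier by auto
  have "x \<otimes> inv y \<in> Tm" using x y Tm_subgroup by (simp add: subgroup.m_closed subgroup.m_inv_closed)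
  moreover have "\<pi> (x \<otimes> inv y) = \<one>\<^bsub>S\<^esub>" using c eq by simp
  ultimately have "x \<otimes> inv y = \<one>" by (rule Tm_trivial_kernel)
  then show "x = y" using c by (metis G.inv_closed G.inv_equality G.inv_inv)
qed

lemma pi_Tm: "x \<in> Tm \<Longrightarrow> \<pi> x \<in> set_pow S A m"
  using pi_T pi_pow_T by (auto simp: set_pow_def)

lemma set_pow_A: "set_pow S A k \<subseteq> A"
  using H.subgroup_nat_pow_closed[OF A] by (auto simp: set_pow_def)

text \<open>The images under \<open>\<pi>\<close> commute because they lie in \<open>A\<close>, and
  injectivity on \<open>Tm\<close> pulls the equation back.\<close>

lemma Tm_comm:
  assumes x: "x \<in> Tm" and y: "y \<in> Tm" shows "x \<otimes> y = y \<otimes> x"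
proof (rule inj_onD[OF inj_on_Tm])
  show "\<pi> (x \<otimes> y) = \<pi> (y \<otimes> x)"
    using A_comm[of "\<pi> x" "\<pi> y"] pi_Tm[OF x] pi_Tm[OF y] set_pow_A Tm_carrier x y by auto
qed (use x y subgroup.m_closed[OF Tm_subgroup] in auto)

lemma TN_eq: "TN = set_pow G Tm n"
  by (rule G.set_pow_mult[OF T_carrier])

lemma TN_normal: "TN \<lhd> G"
  unfolding TN_eq by (rule G.normal_set_pow[OF Tm_normal Tm_comm])

lemma TN_subset: "TN \<subseteq> Tm"
  unfolding TN_eq using G.subgroup_nat_pow_closed[OF Tm_subgroup]
  by (auto simp: set_pow_def[of G Tm])

lemma rho_Tm: "a \<in> A \<Longrightarrow> rho a \<in> Tm"
  using lift_A by (auto simp: rho_def set_pow_def)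

lemma pi_rho: "a \<in> A \<Longrightarrow> \<pi> (rho a) = a [^]\<^bsub>S\<^esub> m"
  using lift_A pi_pow_T by (simp add: rho_def)

lemma rho_surj: "rho ` A = Tm"
proof (intro equalityI subsetI)
  fix x assume "x \<in> Tm"
  then obtain t where t: "t \<in> T" "x = t [^] m" by (auto simp: set_pow_def)
  then have "x = rho (\<pi> t)" using T_bij by (simp add: rho_def bij_betw_def)
  then show "x \<in> rho ` A" using pi_T t by blast
qed (use rho_Tm in auto)

text \<open>Equations in \<open>Tm\<close> may be checked after applying \<open>\<pi>\<close>, where
  \<open>rho\<close> becomes the m-th power map on the abelian group \<open>A\<close>. This map is
  multiplicative, and it is injective by torsion-freeness.\<close>

lemma rho_iso: "rho \<in> iso (S\<lparr>carrier := A\<rparr>) (G\<lparr>carrier := Tm\<rparr>)"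
proof -
  have hom: "rho (a \<otimes>\<^bsub>S\<^esub> b) = rho a \<otimes> rho b" if a: "a \<in> A" and b: "b \<in> A" for a b
  proof (rule inj_onD[OF inj_on_Tm])
    have ab: "a \<otimes>\<^bsub>S\<^esub> b \<in> A" using a b subgroup.m_closed[OF A] by auto
    show "rho (a \<otimes>\<^bsub>S\<^esub> b) \<in> Tm" "rho a \<otimes> rho b \<in> Tm"
      using rho_Tm a b ab subgroup.m_closed[OF Tm_subgroup] by auto
    show "\<pi> (rho (a \<otimes>\<^bsub>S\<^esub> b)) = \<pi> (rho a \<otimes> rho b)"
      using a b ab by (simp add: pi_rho Tm_carrier rho_Tm H.pow_mult_distrib A_comm A_carrier)
  qed
  have "inj_on rho A"
  proof (rule inj_onI)
    fix a b assume a: "a \<in> A" and b: "b \<in> A" and eq: "rho a = rho b"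
    have c: "a \<in> carrier S" "b \<in> carrier S" using A_carrier a b by auto
    have i: "inv\<^bsub>S\<^esub> b \<in> A" using b subgroup.m_inv_closed[OF A] by auto
    have "(a \<otimes>\<^bsub>S\<^esub> inv\<^bsub>S\<^esub> b) [^]\<^bsub>S\<^esub> m = a [^]\<^bsub>S\<^esub> m \<otimes>\<^bsub>S\<^esub> inv\<^bsub>S\<^esub> (b [^]\<^bsub>S\<^esub> m)"
      using a i c by (simp add: H.pow_mult_distrib A_comm H.nat_pow_inv)
    also have "\<dots> = \<one>\<^bsub>S\<^esub>" using pi_rho a b eq c by (metis H.nat_pow_closed H.r_inv)
    finally have "a \<otimes>\<^bsub>S\<^esub> inv\<^bsub>S\<^esub> b = \<one>\<^bsub>S\<^esub>"
      using A_torsion_free m_pos a i subgroup.m_closed[OF A] by blast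
    then show "a = b" using c by (metis H.inv_closed H.inv_equality H.inv_inv)
  qed
  then show ?thesis
    using hom rho_surj rho_Tm by (auto simp: iso_def hom_def bij_betw_def)
qed

lemma rho_pow:
  assumes "a \<in> A" shows "rho (a [^]\<^bsub>S\<^esub> (k::nat)) = rho a [^] k"
proof -
  have "group (S\<lparr>carrier := A\<rparr>)" "group (G\<lparr>carrier := Tm\<rparr>)"
    using A Tm_subgroup H.group_axioms G.group_axioms
    by (auto intro: subgroup.subgroup_is_group)
  then show ?thesis
    using Group.hom_nat_pow[of rho "S\<lparr>carrier := A\<rparr>" "G\<lparr>carrier := Tm\<rparr>" a k] rho_iso assms
    by (simp add: iso_def flip: H.nat_pow_consistent G.nat_pow_consistent)
qed

lemma rho_image_set_pow: "rho ` set_pow S A k = set_pow G Tm k"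
proof -
  have "rho ` set_pow S A k = (\<lambda>x. x [^] k) ` rho ` A"
    unfolding set_pow_def image_image by (rule image_cong) (auto simp: rho_pow)
  then show ?thesis unfolding rho_surj by (simp add: set_pow_def[of G Tm])
qed

text \<open>Through \<open>rho\<close>, the group \<open>Tm\<close> is a copy of \<open>A\<close>,
  hence of the integer lattice. Reduction modulo \<open>n\<close> in each coordinate has the n-th
  powers as its kernel, and these correspond to \<open>TN\<close>; the first isomorphism theorem
  finishes.\<close>

lemma Tm_Mod_TN_iso:
  assumes iso: "(S\<lparr>carrier := A\<rparr>) \<cong> product_group I (\<lambda>_. integer_group)"
  shows "(G\<lparr>carrier := Tm\<rparr> Mod TN) \<cong> product_group I (\<lambda>_. integer_mod_group n)"
proof -
  let ?Z = "product_group I (\<lambda>_. integer_group)"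
  let ?Zn = "product_group I (\<lambda>_. integer_mod_group n)"
  let ?T = "G\<lparr>carrier := Tm\<rparr>"
  have grps: "group (S\<lparr>carrier := A\<rparr>)" "group ?T" "group ?Z" "group ?Zn"
    using A Tm_subgroup H.group_axioms G.group_axioms
    by (auto intro: subgroup.subgroup_is_group)
  obtain f where f: "f \<in> iso ?Z ?T"
    using group.iso_sym[OF grps(1) iso] rho_iso iso_set_trans unfolding is_iso_def by blast
  define g where "g = inv_into (carrier ?Z) f"
  have g: "g \<in> iso ?T ?Z" unfolding g_def by (rule group.iso_set_sym[OF grps(3) f])
  have gc: "g x \<in> carrier ?Z" if "x \<in> Tm" for x
    using g that by (auto simp: iso_def hom_def)
  have gf: "g (f z) = z" if "z \<in> carrier ?Z" for z
    using f that by (auto simp: g_def iso_def bij_betw_def)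
  have fg: "f (g x) = x" if "x \<in> Tm" for x
    using f that by (auto simp: g_def iso_def bij_betw_def f_inv_into_f)
  have fc: "f z \<in> Tm" if "z \<in> carrier ?Z" for z
    using f that by (auto simp: iso_def hom_def)
  define q where "q z = (\<lambda>i\<in>I. z i mod int n)" for z :: "_ \<Rightarrow> int"
  have q: "q \<in> hom ?Z ?Zn"
    using n_pos by (auto simp: hom_def q_def carrier_integer_mod_group mod_simps intro!: restrict_ext)
  have "q \<circ> g \<in> hom ?T ?Zn"
    using g q Group.hom_compose[of g ?T ?Z q ?Zn] by (simp add: iso_def)
  then interpret qg: group_hom ?T ?Zn "q \<circ> g"
    using grps by (simp add: group_hom_def group_hom_axioms_def)
  have surj: "(q \<circ> g) ` carrier ?T = carrier ?Zn"
  proof (intro equalityI subsetI)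
    fix w assume w: "w \<in> carrier ?Zn"
    then have wZ: "w \<in> carrier ?Z" by (auto simp: PiE_def Pi_def)
    \<comment> \<open>Elements of \<open>integer_mod_group n\<close> are represented by the integers
      from 0 to \<open>n - 1\<close>, so a residue vector is its own integer preimage.\<close>
    have "q w = w"
      using w n_pos by (auto simp: q_def carrier_integer_mod_group PiE_def Pi_def extensional_def fun_eq_iff restrict_def)
    then have "(q \<circ> g) (f w) = w" using gf[OF wZ] by simp
    then show "w \<in> (q \<circ> g) ` carrier ?T" using fc[OF wZ] by force
  qed (use qg.hom_closed in auto)
  have powZ: "z [^]\<^bsub>?Z\<^esub> k = (\<lambda>i\<in>I. int k * z i)" if "z \<in> carrier ?Z" for z and k :: nat
    using that by (induction k) (auto simp: algebra_simps intro!: restrict_ext)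
  have f_pow: "f (z [^]\<^bsub>?Z\<^esub> k) = f z [^] k" if "z \<in> carrier ?Z" for z and k :: nat
    using Group.hom_nat_pow[of f ?Z ?T z k] f grps that
    by (simp add: iso_def flip: G.nat_pow_consistent)
  have "kernel ?T ?Zn (q \<circ> g) = TN"
  proof (intro equalityI subsetI)
    fix x assume "x \<in> kernel ?T ?Zn (q \<circ> g)"
    then have x: "x \<in> Tm" and q0: "q (g x) = (\<lambda>i\<in>I. 0)" by (auto simp: kernel_def)
    define z where "z = (\<lambda>i\<in>I. g x i div int n)"
    have z: "z \<in> carrier ?Z" by (auto simp: z_def)
    have "g x i mod int n = 0" if "i \<in> I" for i
      using fun_cong[OF q0, of i] that by (simp add: q_def)
    then have "g x = z [^]\<^bsub>?Z\<^esub> n"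
      using gc[OF x] unfolding powZ[OF z]
      by (auto simp: z_def fun_eq_iff PiE_def extensional_def restrict_def mod_eq_0_iff_dvd)
    then have "x = f z [^] n" using f_pow[OF z] fg[OF x] by metis
    then show "x \<in> TN" using fc[OF z] unfolding TN_eq by (auto simp: set_pow_def)
  next
    fix x assume "x \<in> TN"
    then obtain y where y: "y \<in> Tm" "x = y [^] n" unfolding TN_eq by (auto simp: set_pow_def)
    have "x = f (g y [^]\<^bsub>?Z\<^esub> n)" using f_pow[OF gc[OF y(1)]] fg y by simp
    then have "g x = g y [^]\<^bsub>?Z\<^esub> n" 
      using gf gc[OF y(1)] group.is_monoid[OF grps(3)] by (metis monoid.nat_pow_closed)
    then have "q (g x) = (\<lambda>i\<in>I. 0)" unfolding powZ[OF gc[OF y(1)]] by (auto simp: q_def)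
    then show "x \<in> kernel ?T ?Zn (q \<circ> g)"
      using \<open>x \<in> TN\<close> TN_subset by (auto simp: kernel_def)
  qed
  then show ?thesis using qg.FactGroup_iso[OF surj] by simp
qed

section \<open>The complement as a preimage, and the use of coprimality\<close>

context
  fixes P Q K
  assumes P: "P \<subseteq> carrier G" "\<pi> ` P = Q" and coprime: "coprime n m"
    and K_def: "K = set_pow S A n <#>\<^bsub>S\<^esub> Q" and K: "subgroup K S"
    and K_A: "K \<inter> A = set_pow S A n" and A_K: "A <#>\<^bsub>S\<^esub> K = carrier S"
begin

text \<open>A factorization of \<open>\<pi> g\<close> in \<open>K\<close> lifts factor by factor to
  \<open>T\<close> and \<open>P\<close>; whatever discrepancy remains lies in the kernel.\<close>

lemma preimage_eq:
  "set_pow G T n <#> kernel G S \<pi> <#> P = {g \<in> carrier G. \<pi> g \<in> K}"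
proof (intro equalityI subsetI)
  fix g assume "g \<in> set_pow G T n <#> kernel G S \<pi> <#> P"
  then obtain t k p where t: "t \<in> T" and k: "k \<in> kernel G S \<pi>" and p: "p \<in> P"
    and g: "g = t [^] n \<otimes> k \<otimes> p"
    by (auto simp: set_mult_def set_pow_def)
  have c: "t \<in> carrier G" "k \<in> carrier G" "p \<in> carrier G" "\<pi> k = \<one>\<^bsub>S\<^esub>"
    using t k p T_carrier P by (auto simp: kernel_def)
  have "\<pi> g = \<pi> t [^]\<^bsub>S\<^esub> n \<otimes>\<^bsub>S\<^esub> \<pi> p"
    using c by (simp add: g hom_nat_pow)
  then show "g \<in> {g \<in> carrier G. \<pi> g \<in> K}"
    using c g pi_T[OF t] p P by (auto simp: K_def set_mult_def set_pow_def)
next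
  fix g assume "g \<in> {g \<in> carrier G. \<pi> g \<in> K}"
  then obtain a p where g: "g \<in> carrier G" and a: "a \<in> A" and p: "p \<in> P"
    and eq: "\<pi> g = a [^]\<^bsub>S\<^esub> n \<otimes>\<^bsub>S\<^esub> \<pi> p"
    using P by (auto simp: K_def set_mult_def set_pow_def)
  define t where "t = inv_into T \<pi> a"
  have t: "t \<in> T" "\<pi> t = a" using lift_A[OF a] by (auto simp: t_def)
  have c: "t \<in> carrier G" "p \<in> carrier G" using t p T_carrier P by auto
  \<comment> \<open>Obtained by solving \<open>g = t^n k p\<close> for the middle factor.\<close>
  define k where "k = inv (t [^] n) \<otimes> g \<otimes> inv p"
  have kc: "k \<in> carrier G" using c g by (simp add: k_def)
  have "\<pi> k = inv\<^bsub>S\<^esub> (a [^]\<^bsub>S\<^esub> n) \<otimes>\<^bsub>S\<^esub> (a [^]\<^bsub>S\<^esub> n \<otimes>\<^bsub>S\<^esub> \<pi> p) \<otimes>\<^bsub>S\<^esub> inv\<^bsub>S\<^esub> \<pi> p"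
    using c g t eq by (simp add: k_def hom_nat_pow)
  also have "\<dots> = \<one>\<^bsub>S\<^esub>"
    using c A_carrier[OF a] by (simp add: H.m_assoc H.inv_solve_left)
  finally have "k \<in> kernel G S \<pi>" using kc by (simp add: kernel_def)
  moreover have "g = t [^] n \<otimes> k \<otimes> p"
    using c g by (simp add: k_def G.m_assoc) (simp add: G.m_assoc[symmetric])
  ultimately show "g \<in> set_pow G T n <#> kernel G S \<pi> <#> P"
    using t p by (auto simp: set_mult_def set_pow_def)
qed

lemma bezout: obtains x y :: int where "x * int m + y * int n = 1"
proof -
  have "gcd (int m) (int n) = 1" using coprime by (simp add: coprime_commute)
  then show ?thesis using that bezout_int[of "int m" "int n"] by metis
qed

lemma A_int_pow: "a \<in> A \<Longrightarrow> a [^]\<^bsub>S\<^esub> (i::int) \<in> A"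
  using subgroup.subgroup_is_group[OF A H.group_axioms] H.int_pow_consistent[OF A]
  by (metis group.int_pow_closed partial_object.select_convs(1) partial_object.surjective partial_object.update_convs(1))

text \<open>If \<open>rho a\<close> projects into \<open>K\<close>, then \<open>a^m\<close> lies in
  \<open>K \<inter> A\<close> and is an n-th power. Coprimality of \<open>m\<close> and
  \<open>n\<close> makes \<open>a\<close> itself an n-th power in \<open>A\<close>, so
  \<open>rho a\<close> is one in \<open>Tm\<close>.\<close>

lemma Tm_Int_preimage: "Tm \<inter> {g \<in> carrier G. \<pi> g \<in> K} = TN"
proof (intro equalityI subsetI)
  fix x assume "x \<in> Tm \<inter> {g \<in> carrier G. \<pi> g \<in> K}"
  then have x: "x \<in> Tm" and xK: "\<pi> x \<in> K" by auto
  obtain a where a: "a \<in> A" and xa: "x = rho a" using x rho_surj by auto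
  have "a [^]\<^bsub>S\<^esub> m \<in> set_pow S A n"
    using xK pi_rho[OF a] pi_Tm[OF x] set_pow_A K_A xa by auto
  then obtain c where c: "c \<in> A" and ac: "a [^]\<^bsub>S\<^esub> m = c [^]\<^bsub>S\<^esub> n"
    by (auto simp: set_pow_def)
  obtain u v :: int where uv: "u * int m + v * int n = 1" using bezout .
  have cc: "a \<in> carrier S" "c \<in> carrier S" using a c A_carrier by auto
  \<comment> \<open>The n-th root of \<open>a\<close>: since \<open>u m + v n = 1\<close> and
    \<open>a^m = c^n\<close>, one has \<open>a = (a^m)^u (a^v)^n = (c^u a^v)^n\<close>.\<close>
  let ?b = "c [^]\<^bsub>S\<^esub> u \<otimes>\<^bsub>S\<^esub> a [^]\<^bsub>S\<^esub> v"
  have "a = a [^]\<^bsub>S\<^esub> (int m * u + int n * v)" using uv cc by (simp add: mult.commute)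
  also have "\<dots> = (a [^]\<^bsub>S\<^esub> int m) [^]\<^bsub>S\<^esub> u \<otimes>\<^bsub>S\<^esub> (a [^]\<^bsub>S\<^esub> v) [^]\<^bsub>S\<^esub> int n"
    using cc by (simp add: H.int_pow_mult H.int_pow_pow mult.commute)
  also have "\<dots> = (c [^]\<^bsub>S\<^esub> u) [^]\<^bsub>S\<^esub> int n \<otimes>\<^bsub>S\<^esub> (a [^]\<^bsub>S\<^esub> v) [^]\<^bsub>S\<^esub> int n"
    using cc ac by (metis H.int_pow_pow int_pow_int mult.commute)
  also have "\<dots> = ?b [^]\<^bsub>S\<^esub> n"
    using cc A_int_pow[OF a] A_int_pow[OF c] A_comm by (subst H.pow_mult_distrib) (auto simp: int_pow_int)
  finally have "a = ?b [^]\<^bsub>S\<^esub> n" .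
  moreover have "?b \<in> A" using A_int_pow a c subgroup.m_closed[OF A] by auto
  ultimately have "a \<in> set_pow S A n" by (auto simp: set_pow_def)
  then show "x \<in> TN" unfolding TN_eq rho_image_set_pow[symmetric] xa by blast
next
  fix x assume x: "x \<in> TN"
  then obtain t where t: "t \<in> T" "x = t [^] (n * m)" by (auto simp: set_pow_def)
  then have "\<pi> x = (\<pi> t [^]\<^bsub>S\<^esub> m) [^]\<^bsub>S\<^esub> n"
    using pi_pow_T A_carrier[OF pi_T[OF t(1)]] by (simp add: H.nat_pow_pow mult.commute)
  moreover have "\<pi> t [^]\<^bsub>S\<^esub> m \<in> A"
    using pi_T[OF t(1)] set_pow_A by (auto simp: set_pow_def)
  ultimately have "\<pi> x \<in> K" using K_A by (auto simp: set_pow_def)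
  then show "x \<in> Tm \<inter> {g \<in> carrier G. \<pi> g \<in> K}"
    using x TN_subset Tm_carrier by auto
qed

text \<open>Write \<open>\<pi> g = a k\<close> and split \<open>a\<close> by Bezout into an m-th and
  an n-th power. The m-th power is the projection of an element of \<open>Tm\<close>; the n-th power
  is absorbed into \<open>K\<close>.\<close>

lemma Tm_mult_preimage: "Tm <#> {g \<in> carrier G. \<pi> g \<in> K} = carrier G"
proof (intro equalityI subsetI)
  fix g assume "g \<in> Tm <#> {g \<in> carrier G. \<pi> g \<in> K}"
  then show "g \<in> carrier G" using Tm_carrier by (auto simp: set_mult_def)
next
  fix g assume g: "g \<in> carrier G"
  then have "\<pi> g \<in> A <#>\<^bsub>S\<^esub> K" using A_K by simp
  then obtain a k where a: "a \<in> A" and k: "k \<in> K" and eq: "\<pi> g = a \<otimes>\<^bsub>S\<^esub> k"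
    by (auto simp: set_mult_def)
  obtain u v :: int where uv: "u * int m + v * int n = 1" using bezout .
  have c: "a \<in> carrier S" "k \<in> carrier S" using a A_carrier k subgroup.mem_carrier[OF K] by auto
  let ?x = "rho (a [^]\<^bsub>S\<^esub> u)"
  have x: "?x \<in> Tm" using rho_Tm A_int_pow a by auto
  have "a = a [^]\<^bsub>S\<^esub> (u * int m + v * int n)" using uv c by simp
  also have "\<dots> = \<pi> ?x \<otimes>\<^bsub>S\<^esub> (a [^]\<^bsub>S\<^esub> v) [^]\<^bsub>S\<^esub> n"
    using c pi_rho A_int_pow a
    by (simp add: H.int_pow_mult flip: H.int_pow_pow int_pow_int)
  finally have "\<pi> g = \<pi> ?x \<otimes>\<^bsub>S\<^esub> ((a [^]\<^bsub>S\<^esub> v) [^]\<^bsub>S\<^esub> n \<otimes>\<^bsub>S\<^esub> k)"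
    using eq c Tm_carrier[OF x] by (metis H.int_pow_closed H.m_assoc H.nat_pow_closed hom_closed)
  then have "\<pi> (inv ?x \<otimes> g) = (a [^]\<^bsub>S\<^esub> v) [^]\<^bsub>S\<^esub> n \<otimes>\<^bsub>S\<^esub> k"
    using g c Tm_carrier[OF x] by (simp add: H.m_assoc[symmetric])
  moreover have "(a [^]\<^bsub>S\<^esub> v) [^]\<^bsub>S\<^esub> n \<in> K"
    using K_A A_int_pow[OF a] by (auto simp: set_pow_def)
  ultimately have "inv ?x \<otimes> g \<in> {g \<in> carrier G. \<pi> g \<in> K}"
    using k subgroup.m_closed[OF K] g Tm_carrier[OF x] by auto
  moreover have "g = ?x \<otimes> (inv ?x \<otimes> g)"
    using g Tm_carrier[OF x] by (simp add: G.m_assoc[symmetric])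
  ultimately show "g \<in> Tm <#> {g \<in> carrier G. \<pi> g \<in> K}"
    using x unfolding set_mult_def by blast
qed

lemma semidirect_product_of_lift:
  assumes "H = set_pow G T n <#> kernel G S \<pi> <#> P"
  shows "subgroup H G" "TN \<subseteq> H"
    "internal_semidirect_product (G Mod TN) (carrier (G\<lparr>carrier := Tm\<rparr> Mod TN))
      (carrier (G\<lparr>carrier := H\<rparr> Mod TN))"
proof -
  have H: "H = {g \<in> carrier G. \<pi> g \<in> K}" using assms preimage_eq by simp
  show HG: "subgroup H G" unfolding H by (rule subgroup_preimage[OF K])
  show "TN \<subseteq> H" unfolding H using Tm_Int_preimage by blast
  show "internal_semidirect_product (G Mod TN) (carrier (G\<lparr>carrier := Tm\<rparr> Mod TN))
      (carrier (G\<lparr>carrier := H\<rparr> Mod TN))"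
    by (rule G.internal_semidirect_product_Mod[OF TN_normal Tm_normal HG])
      (use Tm_Int_preimage Tm_mult_preimage H in auto)
qed

end

end

section \<open>Bases of discrete lattices\<close>

abbreviation int_vec :: "nat \<Rightarrow> (nat \<Rightarrow> int) \<Rightarrow> real vec" where
  "int_vec d z \<equiv> vec d (\<lambda>i. real_of_int (z i))"

locale additive_subgroup_vec =
  fixes d :: nat and L :: "real vec set"
  assumes carrier: "L \<subseteq> carrier_vec d"
    and zero: "0\<^sub>v d \<in> L"
    and diff: "u \<in> L \<Longrightarrow> v \<in> L \<Longrightarrow> u - v \<in> L"
begin

lemma carrierD [simp]: "v \<in> L \<Longrightarrow> v \<in> carrier_vec d"
  and dimD [simp]: "v \<in> L \<Longrightarrow> dim_vec v = d"
  using carrier by auto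

lemma uminus: "v \<in> L \<Longrightarrow> - v \<in> L"
  using diff[OF zero, of v] by (metis carrierD minus_add_uminus_vec uminus_carrier_vec zero_carrier_vec left_zero_vec)

lemma add: "u \<in> L \<Longrightarrow> v \<in> L \<Longrightarrow> u + v \<in> L"
  using diff[OF _ uminus, of u v] by (metis carrierD minus_add_uminus_vec uminus_uminus_vec uminus_carrier_vec)

lemma smult_int:
  assumes v: "v \<in> L" shows "real_of_int k \<cdot>\<^sub>v v \<in> L"
proof (induction k rule: int_induct[of _ 0])
  case base
  have "real_of_int 0 \<cdot>\<^sub>v v = 0\<^sub>v d" using v by auto
  then show ?case using zero by simp
next
  case (step1 i)
  have "real_of_int (i + 1) \<cdot>\<^sub>v v = real_of_int i \<cdot>\<^sub>v v + v" by (auto simp: algebra_simps)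
  then show ?case using add[OF step1(2) v] by simp
next
  case (step2 i)
  have "real_of_int (i - 1) \<cdot>\<^sub>v v = real_of_int i \<cdot>\<^sub>v v - v" by (auto simp: algebra_simps)
  then show ?case using diff[OF step2(2) v] by simp
qed

text \<open>The combination is written by coordinates, so that only sums of real numbers
  occur.\<close>

lemma int_combination:
  fixes k :: nat
  assumes w: "\<And>i. i < k \<Longrightarrow> w i \<in> L"
  shows "vec d (\<lambda>r. \<Sum>i<k. real_of_int (z i) * w i $ r) \<in> L"
  using w
proof (induction k)
  case 0
  then show ?case using zero by (simp add: zero_vec_def)
next
  case (Suc k)
  have "vec d (\<lambda>r. \<Sum>i<Suc k. real_of_int (z i) * w i $ r) =
      vec d (\<lambda>r. \<Sum>i<k. real_of_int (z i) * w i $ r) + real_of_int (z k) \<cdot>\<^sub>v w k"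
    using Suc.prems[of k] by (auto simp: algebra_simps)
  then show ?case using Suc add smult_int by auto
qed

end

text \<open>Pigeonhole: cut the box into finitely many cells of side \<open>\<delta>\<close>. Two
  points of \<open>L\<close> in one cell differ by an element of \<open>L\<close> with all
  coordinates below \<open>\<delta>\<close>, so they coincide.\<close>

lemma finite_discrete_box:
  assumes "additive_subgroup_vec d L" and \<delta>: "\<delta> > 0"
    and discrete: "\<And>v. v \<in> L \<Longrightarrow> (\<And>i. i < d \<Longrightarrow> \<bar>v $ i\<bar> < \<delta>) \<Longrightarrow> v = 0\<^sub>v d"
  shows "finite {v \<in> L. \<forall>i<d. \<bar>v $ i\<bar> \<le> 1}"
proof -
  interpret additive_subgroup_vec d L by fact
  define cell where "cell v = (\<lambda>i\<in>{..<d}. \<lfloor>v $ i / \<delta>\<rfloor>)" for v :: "real vec"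
  let ?X = "{v \<in> L. \<forall>i<d. \<bar>v $ i\<bar> \<le> 1}"
  have "cell ` ?X \<subseteq> {..<d} \<rightarrow>\<^sub>E {\<lfloor>-1 / \<delta>\<rfloor>..\<lfloor>1 / \<delta>\<rfloor>}"
  proof (intro image_subsetI PiE_I)
    fix v i assume v: "v \<in> ?X" and i: "i \<in> {..<d}"
    then have "-1 \<le> v $ i" "v $ i \<le> 1" by (auto simp: abs_le_iff)
    then show "cell v i \<in> {\<lfloor>-1 / \<delta>\<rfloor>..\<lfloor>1 / \<delta>\<rfloor>}"
      using \<delta> i by (simp add: cell_def floor_mono divide_right_mono del: divide_minus_left)
  qed (auto simp: cell_def)
  then have "finite (cell ` ?X)" by (rule finite_subset) (auto intro: finite_PiE)
  moreover have "inj_on cell ?X"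
  proof (rule inj_onI)
    fix u v assume u: "u \<in> ?X" and v: "v \<in> ?X" and eq: "cell u = cell v"
    have "\<bar>(u - v) $ i\<bar> < \<delta>" if i: "i < d" for i
    proof -
      have "\<lfloor>u $ i / \<delta>\<rfloor> = \<lfloor>v $ i / \<delta>\<rfloor>" using fun_cong[OF eq, of i] i by (simp add: cell_def)
      then have "\<bar>u $ i / \<delta> - v $ i / \<delta>\<bar> < 1" by linarith
      then have "\<bar>u $ i - v $ i\<bar> / \<delta> < 1" using \<delta> by (simp flip: diff_divide_distrib)
      then show ?thesis using \<delta> u v i by simp
    qed
    then have "u - v = 0\<^sub>v d" using discrete[of "u - v"] diff u v by auto
    then show "u = v" using u v carrierD by (auto simp: vec_eq_iff)
  qed
  ultimately show ?thesis by (rule finite_imageD)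
qed

text \<open>The \<open>i\<close>-th basis vector minimises the positive \<open>i\<close>-th coordinate among the lattice vectors
  whose later coordinates vanish. Subtracting unit vectors brings any competitor into the unit
  box, where only finitely many remain.\<close>

lemma triangular_lattice_basis:
  assumes L: "additive_subgroup_vec d L"
    and unit: "\<And>i. i < d \<Longrightarrow> unit_vec d i \<in> L"
    and fin: "finite {v \<in> L. \<forall>i<d. \<bar>v $ i\<bar> \<le> 1}"
  obtains W where "W \<in> carrier_mat d d" "det W \<noteq> 0" "L = {W *\<^sub>v int_vec d z | z. True}"
proof -
  interpret additive_subgroup_vec d L by fact
  have minimal: "\<exists>w\<in>L. w $ i > 0 \<and> (\<forall>j. i < j \<and> j < d \<longrightarrow> w $ j = 0) \<and>
      (\<forall>v\<in>L. (\<forall>j. i < j \<and> j < d \<longrightarrow> v $ j = 0) \<and> v $ i > 0 \<longrightarrow> w $ i \<le> v $ i)"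
    if i: "i < d" for i
  proof -
    let ?X = "{v \<in> L. \<forall>i<d. \<bar>v $ i\<bar> \<le> 1}"
    let ?Y = "{v \<in> ?X. v $ i > 0 \<and> (\<forall>j. i < j \<and> j < d \<longrightarrow> v $ j = 0)}"
    have finY: "finite ?Y" by (rule finite_subset[OF _ fin]) auto
    have uY: "unit_vec d i \<in> ?Y" using i unit by auto
    obtain w where w: "w \<in> ?Y" and le: "\<And>v. v \<in> ?Y \<Longrightarrow> w $ i \<le> v $ i"
      using arg_min_if_finite[OF finY, of "\<lambda>v. v $ i"] uY
      by (metis (no_types, lifting) empty_iff linorder_not_less)
    have "w $ i \<le> v $ i" if v: "v \<in> L" and z: "\<forall>j. i < j \<and> j < d \<longrightarrow> v $ j = 0" and pos: "v $ i > 0" for v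
    proof (cases "v $ i \<le> 1")
      \<comment> \<open>The minimizer \<open>w\<close> lies in the unit box, so its coordinate is at
        most 1 and a larger competitor cannot beat it.\<close>
      case False
      then show ?thesis using w i by auto
    next
      case True
      define u where "u = v - vec d (\<lambda>r. \<Sum>j<i. real_of_int \<lfloor>v $ j\<rfloor> * unit_vec d j $ r)"
      have "u \<in> L" unfolding u_def
        using i by (intro diff v int_combination unit) auto
      have u: "u $ r = (if r < i then frac (v $ r) else v $ r)" if r: "r < d" for r
      proof -
        have "(\<Sum>j<i. real_of_int \<lfloor>v $ j\<rfloor> * unit_vec d j $ r) = (if r < i then real_of_int \<lfloor>v $ r\<rfloor> else 0)"
          using r i by (auto simp: unit_vec_def if_distrib cong: if_cong)
        then show ?thesis using r v by (simp add: u_def frac_def)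
      qed
      have "u \<in> ?Y"
      proof -
        have "\<bar>u $ r\<bar> \<le> 1" if "r < d" for r
        proof (cases r i rule: linorder_cases)
          case less
          then show ?thesis using u[OF that] frac_lt_1[of "v $ r"] frac_ge_0[of "v $ r"] by simp
        next
          case equal
          then show ?thesis using u[OF that] pos True by simp
        next
          case greater
          then show ?thesis using u[OF that] z that by simp
        qed
        then show ?thesis using \<open>u \<in> L\<close> u i pos z by auto
      qed
      then have "w $ i \<le> u $ i" by (rule le)
      then show ?thesis using u i by simp
    qed
    then show ?thesis using w by blast
  qed
  obtain w where w: "\<And>i. i < d \<Longrightarrow> w i \<in> L" and pos: "\<And>i. i < d \<Longrightarrow> w i $ i > 0"
    and zero: "\<And>i j. i < j \<Longrightarrow> j < d \<Longrightarrow> w i $ j = 0"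
    and least: "\<And>i v. i < d \<Longrightarrow> v \<in> L \<Longrightarrow> (\<And>j. i < j \<Longrightarrow> j < d \<Longrightarrow> v $ j = 0) \<Longrightarrow> v $ i > 0 \<Longrightarrow> w i $ i \<le> v $ i"
  proof -
    have "\<forall>i. \<exists>w. i < d \<longrightarrow> w \<in> L \<and> w $ i > 0 \<and> (\<forall>j. i < j \<and> j < d \<longrightarrow> w $ j = 0) \<and>
      (\<forall>v\<in>L. (\<forall>j. i < j \<and> j < d \<longrightarrow> v $ j = 0) \<and> v $ i > 0 \<longrightarrow> w $ i \<le> v $ i)"
      using minimal by blast
    from choice[OF this] obtain w where w: "\<forall>i. i < d \<longrightarrow> w i \<in> L \<and> w i $ i > 0 \<and> (\<forall>j. i < j \<and> j < d \<longrightarrow> w i $ j = 0) \<and>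
      (\<forall>v\<in>L. (\<forall>j. i < j \<and> j < d \<longrightarrow> v $ j = 0) \<and> v $ i > 0 \<longrightarrow> w i $ i \<le> v $ i)" ..
    show ?thesis
    proof (rule that[of w])
      show "w i $ j = 0" if "i < j" "j < d" for i j
        using w less_trans[OF that] that by blast
    qed (use w in blast)+
  qed
  \<comment> \<open>Division with remainder, from the last nonzero coordinate downwards: subtracting
    an integer multiple of \<open>w k\<close> clears coordinate \<open>k\<close> without disturbing
    the vanishing later ones.\<close>
  have spans: "\<exists>z. \<forall>r<d. v $ r = (\<Sum>i<k. real_of_int (z i) * w i $ r)"
    if "k \<le> d" "v \<in> L" "\<And>j. k \<le> j \<Longrightarrow> j < d \<Longrightarrow> v $ j = 0" for k v
    using that
  proof (induction k arbitrary: v)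
    case 0
    then show ?case by auto
  next
    case (Suc k)
    have k: "k < d" using Suc.prems by simp
    define q where "q = \<lfloor>v $ k / w k $ k\<rfloor>"
    define u where "u = v - real_of_int q \<cdot>\<^sub>v w k"
    have uL: "u \<in> L" unfolding u_def by (intro diff Suc.prems smult_int w k)
    have ur: "u $ r = v $ r - real_of_int q * w k $ r" if "r < d" for r
      using that w[OF k] by (simp add: u_def)
    have high: "u $ j = 0" if "k < j" "j < d" for j
      using ur[OF that(2)] zero[OF that] Suc.prems(3)[of j] that by simp
    have "real_of_int q * w k $ k \<le> v $ k" "v $ k < (real_of_int q + 1) * w k $ k"
      using pos[OF k] by (auto simp: q_def floor_divide_lower floor_divide_upper)
    then have "0 \<le> u $ k" "u $ k < w k $ k" using ur[OF k] by (auto simp: algebra_simps)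
    \<comment> \<open>The remainder is nonnegative and smaller than \<open>w k $ k\<close>; a
      positive one would contradict the minimality of \<open>w k\<close>.\<close>
    then have "u $ k = 0" using least[OF k uL high] by force
    then have "u $ j = 0" if "k \<le> j" "j < d" for j
      using high that by (cases "j = k") auto
    then obtain z where z: "\<And>r. r < d \<Longrightarrow> u $ r = (\<Sum>i<k. real_of_int (z i) * w i $ r)"
      using Suc.IH[OF _ uL] k by auto
    have "\<forall>r<d. v $ r = (\<Sum>i<Suc k. real_of_int ((z(k := q)) i) * w i $ r)"
      using ur z by (simp add: algebra_simps)
    then show ?case by blast
  qed
  define W where "W = mat d d (\<lambda>(r, i). w i $ r)"
  have W: "W \<in> carrier_mat d d" by (simp add: W_def)
  have Wz: "W *\<^sub>v int_vec d z = vec d (\<lambda>r. \<Sum>i<d. real_of_int (z i) * w i $ r)" for z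
    by (auto simp: W_def scalar_prod_def mult.commute lessThan_atLeast0 intro!: sum.cong)
  have "upper_triangular W" using zero by (auto simp: W_def)
  then have "det W = prod_list (diag_mat W)" using W by (rule det_upper_triangular)
  moreover have "0 \<notin> set (diag_mat W)" using pos by (auto simp: diag_mat_def W_def) (metis less_irrefl)
  ultimately have "det W \<noteq> 0" by (simp add: prod_list_zero_iff)
  moreover have "L = {W *\<^sub>v int_vec d z | z. True}"
  proof (intro equalityI subsetI)
    fix v assume v: "v \<in> L"
    then obtain z where "\<forall>r<d. v $ r = (\<Sum>i<d. real_of_int (z i) * w i $ r)"
      using spans[of d v] by auto
    then have "v = W *\<^sub>v int_vec d z" unfolding Wz using v by auto
    then show "v \<in> {W *\<^sub>v int_vec d z | z. True}" by blast
  next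
    fix v assume "v \<in> {W *\<^sub>v int_vec d z | z. True}"
    then show "v \<in> L" unfolding Wz using int_combination[of d w] w by auto
  qed
  ultimately show ?thesis using W that by blast
qed

text \<open>A nonzero kernel vector would be a linear dependency among the columns. Enumerating
  \<open>B\<close> without repetition ensures that it is a dependency of the set
  \<open>B\<close>.\<close>

lemma matrix_with_independent_columns:
  fixes B :: "real vec set"
  assumes B: "B \<subseteq> carrier_vec d" "finite B" "card B = d"
    and indep: "\<not> module.lin_dep class_ring (module_vec TYPE(real) d) B"
  obtains M where "M \<in> carrier_mat d d" "det M \<noteq> 0" "set (cols M) = B"
proof -
  interpret vec_space "TYPE(real)" d .
  obtain bs where bs: "set bs = B" "distinct bs" using finite_distinct_list[OF B(2)] by blast
  have len: "length bs = d" using bs B(3) distinct_card by metis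
  define M where "M = mat_of_cols d bs"
  have M: "M \<in> carrier_mat d d" using mat_of_cols_carrier(1)[of d bs] len by (simp add: M_def)
  have cols: "cols M = bs" using bs B(1) by (simp add: M_def cols_mat_of_cols)
  have "det M \<noteq> 0"
  proof
    assume "det M = 0"
    then obtain v where "v \<in> carrier_vec d" "v \<noteq> 0\<^sub>v d" "M *\<^sub>v v = 0\<^sub>v d"
      using det_0_iff_vec_prod_zero[OF M] by blast
    then have "lin_dep (set (cols M))" using lin_depI[OF M] bs cols by simp
    then show False using indep bs cols by simp
  qed
  then show ?thesis using that M bs cols by simp
qed

text \<open>A crude operator bound for the maximum norm: one constant, the sum of all absolute
  entries, serves every row.\<close>

lemma abs_mult_mat_vec_le:
  fixes M :: "real mat"
  assumes M: "M \<in> carrier_mat d d" and v: "v \<in> carrier_vec d"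
    and \<delta>: "\<And>j. j < d \<Longrightarrow> \<bar>v $ j\<bar> \<le> \<delta>" and i: "i < d"
  shows "\<bar>(M *\<^sub>v v) $ i\<bar> \<le> (\<Sum>i<d. \<Sum>j<d. \<bar>M $$ (i, j)\<bar>) * \<delta>"
proof -
  have \<delta>0: "\<delta> \<ge> 0" using \<delta>[OF i] by linarith
  have "\<bar>(M *\<^sub>v v) $ i\<bar> = \<bar>\<Sum>j<d. M $$ (i, j) * v $ j\<bar>"
    using M v i by (simp add: scalar_prod_def lessThan_atLeast0)
  also have "\<dots> \<le> (\<Sum>j<d. \<bar>M $$ (i, j) * v $ j\<bar>)" by (rule sum_abs)
  also have "\<dots> \<le> (\<Sum>j<d. \<bar>M $$ (i, j)\<bar> * \<delta>)"
    using \<delta> by (intro sum_mono) (auto simp: abs_mult intro: mult_left_mono)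
  also have "\<dots> = (\<Sum>j<d. \<bar>M $$ (i, j)\<bar>) * \<delta>" by (simp add: sum_distrib_right)
  also have "\<dots> \<le> (\<Sum>i<d. \<Sum>j<d. \<bar>M $$ (i, j)\<bar>) * \<delta>"
    using i \<delta>0 by (intro mult_right_mono member_le_sum[of i "{..<d}" "\<lambda>i. \<Sum>j<d. \<bar>M $$ (i, j)\<bar>"]) (auto intro: sum_nonneg)
  finally show ?thesis .
qed

text \<open>In coordinates with respect to the columns of \<open>M\<close>, the vectors of
  \<open>B\<close> become the unit vectors, so \<open>triangular_lattice_basis\<close> applies.
  Discreteness survives the change of coordinates because \<open>M\<close> is bounded, and
  multiplying by \<open>M\<close> carries the basis back.\<close>

lemma lattice_basis:
  assumes L: "additive_subgroup_vec d L"
    and \<epsilon>: "\<epsilon> > 0" and discrete: "\<And>v. v \<in> L \<Longrightarrow> (\<Sum>i<d. (v $ i)\<^sup>2) < \<epsilon>\<^sup>2 \<Longrightarrow> v = 0\<^sub>v d"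
    and B: "B \<subseteq> L" "finite B" "card B = d"
    and indep: "\<not> module.lin_dep class_ring (module_vec TYPE(real) d) B"
  obtains W where "W \<in> carrier_mat d d" "det W \<noteq> 0" "L = {W *\<^sub>v int_vec d z | z. True}"
proof -
  interpret additive_subgroup_vec d L by fact
  obtain M where M: "M \<in> carrier_mat d d" and det: "det M \<noteq> 0" and cols: "set (cols M) = B"
    using matrix_with_independent_columns[OF _ B(2,3) indep] B(1) carrier by blast
  have inj: "v = 0\<^sub>v d" if "v \<in> carrier_vec d" "M *\<^sub>v v = 0\<^sub>v d" for v
    using that det det_0_iff_vec_prod_zero[OF M] by blast
  obtain M' where M': "M' \<in> carrier_mat d d" "M * M' = 1\<^sub>m d"
    using det_non_zero_imp_unit[OF M det, of "()"] M
    by (auto simp: Units_def ring_mat_def)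
  define L' where "L' = {c \<in> carrier_vec d. M *\<^sub>v c \<in> L}"
  have L': "additive_subgroup_vec d L'"
  proof
    have "M *\<^sub>v 0\<^sub>v d = 0\<^sub>v d" using M by auto
    then show "0\<^sub>v d \<in> L'" using zero by (simp add: L'_def)
  qed (use M diff in \<open>auto simp: L'_def mult_minus_distrib_mat_vec\<close>)
  have unit: "unit_vec d i \<in> L'" if "i < d" for i
  proof -
    have "M *\<^sub>v unit_vec d i = col M i" using M that by (intro eq_vecI) (auto simp: scalar_prod_right_unit)
    moreover have "col M i \<in> set (cols M)" using M that by (metis carrier_matD(2) cols_length cols_nth nth_mem)
    ultimately show ?thesis using cols B(1) by (auto simp: L'_def)
  qed
  define C where "C = (\<Sum>i<d. \<Sum>j<d. \<bar>M $$ (i, j)\<bar>)"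
  have C: "C \<ge> 0" by (auto simp: C_def intro!: sum_nonneg)
  \<comment> \<open>Chosen so that \<open>d (C \<delta>)^2 < \<epsilon>^2\<close>. The added ones
    keep the denominator positive when \<open>d\<close> or \<open>C\<close> is 0 and make the
    estimate strict.\<close>
  define \<delta> where "\<delta> = \<epsilon> / ((real d + 1) * (C + 1))"
  have \<delta>: "\<delta> > 0" using \<epsilon> C by (simp add: \<delta>_def)
  have small: "c = 0\<^sub>v d" if c: "c \<in> L'" and le: "\<And>i. i < d \<Longrightarrow> \<bar>c $ i\<bar> < \<delta>" for c
  proof -
    have cc: "c \<in> carrier_vec d" using c by (simp add: L'_def)
    have bound: "\<bar>(M *\<^sub>v c) $ i\<bar> \<le> C * \<delta>" if "i < d" for i
      unfolding C_def using abs_mult_mat_vec_le[OF M cc _ that] le by (simp add: less_imp_le)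
    have "(\<Sum>i<d. ((M *\<^sub>v c) $ i)\<^sup>2) \<le> (\<Sum>i<d. (C * \<delta>)\<^sup>2)"
      using bound C \<delta> by (intro sum_mono) (metis abs_ge_zero lessThan_iff power2_abs power_mono)
    also have "\<dots> = real d * (C * \<delta>)\<^sup>2" by simp
    also have "\<dots> \<le> (real d + 1)\<^sup>2 * (C * \<delta>)\<^sup>2"
      by (intro mult_right_mono) (simp_all add: power2_sum)
    also have "\<dots> = ((real d + 1) * \<delta>)\<^sup>2 * C\<^sup>2" by (simp add: power_mult_distrib)
    also have "\<dots> < ((real d + 1) * \<delta>)\<^sup>2 * (C + 1)\<^sup>2"
      using C \<delta> by (intro mult_strict_left_mono) (auto simp: power_strict_mono)
    also have "\<dots> = \<epsilon>\<^sup>2" using C by (simp add: \<delta>_def flip: power_mult_distrib)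
    finally have "M *\<^sub>v c = 0\<^sub>v d" using discrete c by (simp add: L'_def)
    then show ?thesis using inj cc by blast
  qed
  obtain W where W: "W \<in> carrier_mat d d" "det W \<noteq> 0" and L'W: "L' = {W *\<^sub>v int_vec d z | z. True}"
    using triangular_lattice_basis[OF L' unit finite_discrete_box[OF L' \<delta> small]] by blast
  have "L = {(M * W) *\<^sub>v int_vec d z | z. True}"
  proof (intro equalityI subsetI)
    fix v assume v: "v \<in> L"
    have v': "v = M *\<^sub>v (M' *\<^sub>v v)" using M M' v by (simp flip: assoc_mult_mat_vec)
    then have "M' *\<^sub>v v \<in> L'" using v M' by (simp add: L'_def)
    then obtain z where "M' *\<^sub>v v = W *\<^sub>v int_vec d z" using L'W by auto
    then have "v = (M * W) *\<^sub>v int_vec d z" using v' M W by simp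
    then show "v \<in> {(M * W) *\<^sub>v int_vec d z | z. True}" by blast
  next
    fix v assume "v \<in> {(M * W) *\<^sub>v int_vec d z | z. True}"
    then obtain z where v: "v = (M * W) *\<^sub>v int_vec d z" by blast
    have "W *\<^sub>v int_vec d z \<in> L'" using L'W by blast
    then show "v \<in> L" using v M W by (simp add: L'_def)
  qed
  moreover have "det (M * W) \<noteq> 0" using det_mult[OF M W(1)] det W by simp
  ultimately show ?thesis using that[of "M * W"] M W by simp
qed

section \<open>Subgroups of the Euclidean group\<close>

lemma carrier_euclidean_group [simp]:
    "carrier (euclidean_group d) = orthogonal_group d \<times> carrier_vec d"
  and mult_euclidean_group [simp]:
    "(A, b) \<otimes>\<^bsub>euclidean_group d\<^esub> (A', b') = (A * A', b + A *\<^sub>v b')"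
  and one_euclidean_group [simp]: "\<one>\<^bsub>euclidean_group d\<^esub> = (1\<^sub>m d, 0\<^sub>v d)"
  by (auto simp: euclidean_group_def)

lemma orthogonal_groupD:
  assumes "A \<in> orthogonal_group d"
  shows "A \<in> carrier_mat d d" "transpose_mat A * A = 1\<^sub>m d" "A * transpose_mat A = 1\<^sub>m d"
  using assms mat_mult_left_right_inverse[of "transpose_mat A" d A] by (auto simp: orthogonal_group_def)

lemma orthogonal_group_one: "1\<^sub>m d \<in> orthogonal_group d"
  by (simp add: orthogonal_group_def)

lemma orthogonal_group_transpose:
  assumes "A \<in> orthogonal_group d" shows "transpose_mat A \<in> orthogonal_group d"
  using orthogonal_groupD(1,3)[OF assms] by (simp add: orthogonal_group_def)

lemma orthogonal_group_mult:
  assumes "A \<in> orthogonal_group d" "B \<in> orthogonal_group d"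
  shows "A * B \<in> orthogonal_group d"
proof -
  note A = orthogonal_groupD[OF assms(1)] and B = orthogonal_groupD[OF assms(2)]
  have "transpose_mat (A * B) * (A * B) = transpose_mat B * (transpose_mat A * (A * B))"
    using A(1) B(1) by (simp add: transpose_mult[OF A(1) B(1)] assoc_mult_mat[of _ d d _ d _ d])
  also have "transpose_mat A * (A * B) = (transpose_mat A * A) * B"
    using A(1) B(1) by (intro assoc_mult_mat[symmetric]) auto
  finally show ?thesis using A B by (simp add: orthogonal_group_def)
qed

lemma group_euclidean_group: "group (euclidean_group d)"
proof (rule groupI)
  fix x y z
  assume "x \<in> carrier (euclidean_group d)" "y \<in> carrier (euclidean_group d)"
    "z \<in> carrier (euclidean_group d)"
  then show "x \<otimes>\<^bsub>euclidean_group d\<^esub> y \<otimes>\<^bsub>euclidean_group d\<^esub> z =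
      x \<otimes>\<^bsub>euclidean_group d\<^esub> (y \<otimes>\<^bsub>euclidean_group d\<^esub> z)"
    by (cases x, cases y, cases z)
      (auto dest!: orthogonal_groupD(1) simp: mult_add_distrib_mat_vec[where nr = d and nc = d]
        assoc_mult_mat[of _ d d _ d _ d] assoc_add_vec[of _ d])
next
  fix x assume "x \<in> carrier (euclidean_group d)"
  then obtain A b where x: "x = (A, b)" "A \<in> orthogonal_group d" "b \<in> carrier_vec d" by auto
  note A = orthogonal_groupD[OF x(2)]
  have "transpose_mat A *\<^sub>v (- b) + transpose_mat A *\<^sub>v b = 0\<^sub>v d"
    using A(1) x(3) mult_add_distrib_mat_vec[of "transpose_mat A" d d "- b" b] by auto
  then show "\<exists>y\<in>carrier (euclidean_group d). y \<otimes>\<^bsub>euclidean_group d\<^esub> x = \<one>\<^bsub>euclidean_group d\<^esub>"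
    using x A orthogonal_group_transpose
    by (intro bexI[of _ "(transpose_mat A, transpose_mat A *\<^sub>v (- b))"]) auto
next
  fix x y assume "x \<in> carrier (euclidean_group d)" "y \<in> carrier (euclidean_group d)"
  then show "x \<otimes>\<^bsub>euclidean_group d\<^esub> y \<in> carrier (euclidean_group d)"
    using orthogonal_groupD(1)[of "fst x" d]
    by (cases x, cases y) (simp add: orthogonal_group_mult)
next
  fix x assume "x \<in> carrier (euclidean_group d)"
  then show "\<one>\<^bsub>euclidean_group d\<^esub> \<otimes>\<^bsub>euclidean_group d\<^esub> x = x"
    using orthogonal_groupD(1)[of "fst x" d] by (cases x) simp
qed (simp add: orthogonal_group_one)

lemma dsum_mult:
  assumes A: "A \<in> orthogonal_group d1" "A' \<in> orthogonal_group d1"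
    and g: "g \<in> carrier (euclidean_group d2)" "g' \<in> carrier (euclidean_group d2)"
  shows "dsum A g \<otimes>\<^bsub>euclidean_group (d1 + d2)\<^esub> dsum A' g' =
    dsum (A * A') (g \<otimes>\<^bsub>euclidean_group d2\<^esub> g')"
proof -
  obtain B b B' b' where gb: "g = (B, b)" "g' = (B', b')" by (cases g, cases g')
  have c: "A \<in> carrier_mat d1 d1" "A' \<in> carrier_mat d1 d1"
    "B \<in> carrier_mat d2 d2" "B' \<in> carrier_mat d2 d2" "b \<in> carrier_vec d2" "b' \<in> carrier_vec d2"
    using A g gb orthogonal_groupD(1) by auto
  have "four_block_mat A (0\<^sub>m d1 d2) (0\<^sub>m d2 d1) B * four_block_mat A' (0\<^sub>m d1 d2) (0\<^sub>m d2 d1) B' =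
      four_block_mat (A * A') (0\<^sub>m d1 d2) (0\<^sub>m d2 d1) (B * B')"
    using c by (subst mult_four_block_mat[of _ d1 d1 _ d2 _ d2 _ _ d1 _ d2]) auto
  moreover have "four_block_mat A (0\<^sub>m d1 d2) (0\<^sub>m d2 d1) B *\<^sub>v (0\<^sub>v d1 @\<^sub>v b') = 0\<^sub>v d1 @\<^sub>v (B *\<^sub>v b')"
    using c by (subst four_block_mat_mult_vec[of _ d1 d1 _ d2 _ d2]) auto
  moreover have "(0\<^sub>v d1 @\<^sub>v b) + (0\<^sub>v d1 @\<^sub>v (B *\<^sub>v b')) = 0\<^sub>v d1 @\<^sub>v (b + B *\<^sub>v b')"
    using c by (intro eq_vecI) (auto simp: append_vec_def Let_def)
  ultimately show ?thesis using c by (simp add: dsum_def gb)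
qed

text \<open>Extracting the lower right block is not multiplicative on arbitrary matrices; it is on
  block-diagonal ones, and the inclusion in \<open>orth_dsum d1 S\<close> provides this
  shape.\<close>

lemma group_hom_proj:
  assumes G: "subgroup G (euclidean_group (d1 + d2))" and S: "subgroup S (euclidean_group d2)"
    and GS: "G \<subseteq> orth_dsum d1 S"
  shows "group_hom (eucl_sub (d1 + d2) G) (eucl_sub d2 S) (proj d1 d2)"
proof -
  have dec: "\<exists>A s. A \<in> orthogonal_group d1 \<and> s \<in> S \<and> g = dsum A s" if "g \<in> G" for g
    using that GS unfolding orth_dsum_def by blast
  note Sc = subgroup.mem_carrier[OF S]
  have "proj d1 d2 \<in> hom (eucl_sub (d1 + d2) G) (eucl_sub d2 S)"
  proof (rule homI)
    fix x assume "x \<in> carrier (eucl_sub (d1 + d2) G)"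
    then show "proj d1 d2 x \<in> carrier (eucl_sub d2 S)"
      using dec[of x] Sc by (auto simp: proj_dsum simp del: carrier_euclidean_group)
  next
    fix x y assume "x \<in> carrier (eucl_sub (d1 + d2) G)" "y \<in> carrier (eucl_sub (d1 + d2) G)"
    then obtain A s B t where "A \<in> orthogonal_group d1" "s \<in> S" "x = dsum A s"
      "B \<in> orthogonal_group d1" "t \<in> S" "y = dsum B t"
      using dec[of x] dec[of y] by auto
    then show "proj d1 d2 (x \<otimes>\<^bsub>eucl_sub (d1 + d2) G\<^esub> y) =
        proj d1 d2 x \<otimes>\<^bsub>eucl_sub d2 S\<^esub> proj d1 d2 y"
      using Sc subgroup.m_closed[OF S]
      by (simp add: dsum_mult proj_dsum orthogonal_group_mult del: carrier_euclidean_group)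
  qed
  then show ?thesis
    using subgroup.subgroup_is_group[OF G group_euclidean_group]
      subgroup.subgroup_is_group[OF S group_euclidean_group]
    by (simp add: group_hom_def group_hom_axioms_def)
qed

lemma translation_nat_pow:
  "v \<in> carrier_vec d \<Longrightarrow> (1\<^sub>m d, v) [^]\<^bsub>euclidean_group d\<^esub> (k::nat) = (1\<^sub>m d, real k \<cdot>\<^sub>v v)"
proof (induction k)
  case 0
  then show ?case by auto
next
  case (Suc k)
  have "real k \<cdot>\<^sub>v v + v = real (Suc k) \<cdot>\<^sub>v v" by (auto simp: algebra_simps)
  then show ?case using Suc by simp
qed

section \<open>Translations and point group of a subgroup of the Euclidean group\<close>

locale euclidean_subgroup =
  fixes d :: nat and S :: "isometry set"
  assumes S: "subgroup S (euclidean_group d)"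
begin

sublocale E: group "euclidean_group d" by (rule group_euclidean_group)

definition translation_lattice where "translation_lattice = {v. (1\<^sub>m d, v) \<in> S}"

abbreviation "\<Lambda> \<equiv> translation_lattice"

lemma S_carrier: "(P, b) \<in> S \<Longrightarrow> P \<in> orthogonal_group d \<and> P \<in> carrier_mat d d \<and> b \<in> carrier_vec d"
  using subgroup.mem_carrier[OF S] orthogonal_groupD(1) by force

lemma point_group_carrier: "P \<in> point_group S \<Longrightarrow> P \<in> carrier_mat d d"
  using S_carrier by auto

lemma S_mult: "(P, b) \<in> S \<Longrightarrow> (Q, c) \<in> S \<Longrightarrow> (P * Q, b + P *\<^sub>v c) \<in> S"
  using subgroup.m_closed[OF S, of "(P, b)" "(Q, c)"] by simp

lemma lattice_iff: "v \<in> \<Lambda> \<longleftrightarrow> (1\<^sub>m d, v) \<in> S"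
  by (simp add: translation_lattice_def)

lemma lattice_carrier: "v \<in> \<Lambda> \<Longrightarrow> v \<in> carrier_vec d"
  using S_carrier by (auto simp: lattice_iff)

lemma translation_group_eq: "translation_group d S = Pair (1\<^sub>m d) ` \<Lambda>"
  by (auto simp: translation_group_def translation_lattice_def)

text \<open>The quotient of \<open>(P, c)\<close> by \<open>(P, b)\<close> is the translation by
  \<open>c - b\<close>. It is identified by solving an equation, without computing an
  inverse.\<close>

lemma lattice_diff:
  assumes b: "(P, b) \<in> S" and c: "(P, c) \<in> S"
  shows "c - b \<in> \<Lambda>"
proof -
  note bc = S_carrier[OF b] S_carrier[OF c]
  have "c - b + b = c" using bc by auto
  then have "(1\<^sub>m d, c - b) \<otimes>\<^bsub>euclidean_group d\<^esub> (P, b) = (P, c)"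
    using bc by (simp add: left_mult_one_mat[of P d d])
  moreover have "(1\<^sub>m d, c - b) \<in> carrier (euclidean_group d)"
    using bc by (simp add: orthogonal_group_one)
  ultimately have "(1\<^sub>m d, c - b) = (P, c) \<otimes>\<^bsub>euclidean_group d\<^esub> inv\<^bsub>euclidean_group d\<^esub> (P, b)"
    using E.inv_solve_right subgroup.mem_carrier[OF S] b c by metis
  also have "\<dots> \<in> S" using b c S by (simp add: subgroup.m_closed subgroup.m_inv_closed)
  finally show ?thesis by (simp add: lattice_iff)
qed

lemma lattice_subgroup: "additive_subgroup_vec d \<Lambda>"
proof
  show "\<Lambda> \<subseteq> carrier_vec d" using lattice_carrier by auto
  show "0\<^sub>v d \<in> \<Lambda>" using subgroup.one_closed[OF S] by (simp add: lattice_iff)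
  show "u - v \<in> \<Lambda>" if "u \<in> \<Lambda>" "v \<in> \<Lambda>" for u v
    using lattice_diff[of "1\<^sub>m d" v u] that by (simp add: lattice_iff)
qed

sublocale \<Lambda>: additive_subgroup_vec d \<Lambda> by (rule lattice_subgroup)

text \<open>Multiplying \<open>(P, b)\<close> on the right by the translation \<open>v\<close> keeps
  the linear part and adds \<open>P *\<^sub>v v\<close> to the translation part, so
  \<open>lattice_diff\<close> applies.\<close>

lemma lattice_point_group:
  assumes P: "P \<in> point_group S" and v: "v \<in> \<Lambda>"
  shows "P *\<^sub>v v \<in> \<Lambda>"
proof -
  obtain b where b: "(P, b) \<in> S" using P by auto
  note bc = S_carrier[OF b] lattice_carrier[OF v]
  have "(P * 1\<^sub>m d, b + P *\<^sub>v v) \<in> S" by (rule S_mult[OF b]) (use v in \<open>simp add: lattice_iff\<close>)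
  then have "(P, b + P *\<^sub>v v) \<in> S" using bc by (simp add: right_mult_one_mat[of P d d])
  then have "b + P *\<^sub>v v - b \<in> \<Lambda>" by (rule lattice_diff[OF b])
  moreover have "b + P *\<^sub>v v - b = P *\<^sub>v v" using bc by auto
  ultimately show ?thesis by simp
qed

lemma point_group_one: "1\<^sub>m d \<in> point_group S"
  using imageI[OF subgroup.one_closed[OF S], of fst] by simp

lemma point_group_mult:
  assumes "P \<in> point_group S" "Q \<in> point_group S" shows "P * Q \<in> point_group S"
proof -
  obtain b c where "(P, b) \<in> S" "(Q, c) \<in> S" using assms by auto
  from imageI[OF S_mult[OF this], of fst] show ?thesis by simp
qed

lemma point_group_inverse:
  assumes "P \<in> point_group S" obtains Q where "Q \<in> point_group S" "Q * P = 1\<^sub>m d"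
proof -
  obtain b where b: "(P, b) \<in> S" using assms by auto
  obtain Q c where Qc: "inv\<^bsub>euclidean_group d\<^esub> (P, b) = (Q, c)" by (rule prod.exhaust)
  then have QS: "(Q, c) \<in> S" using subgroup.m_inv_closed[OF S b] by simp
  have "(Q, c) \<otimes>\<^bsub>euclidean_group d\<^esub> (P, b) = \<one>\<^bsub>euclidean_group d\<^esub>"
    unfolding Qc[symmetric] by (rule E.l_inv) (rule subgroup.mem_carrier[OF S b])
  then show ?thesis using that[of Q] imageI[OF QS, of fst] by simp
qed

lemma translation_subgroup: "subgroup (translation_group d S) (euclidean_group d)"
proof (rule E.subgroupI)
  show "translation_group d S \<subseteq> carrier (euclidean_group d)"
    using subgroup.subset[OF S] by (auto simp: translation_group_def)
  show "translation_group d S \<noteq> {}" using \<Lambda>.zero by (auto simp: translation_group_eq)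
next
  fix x assume "x \<in> translation_group d S"
  then obtain v where v: "v \<in> \<Lambda>" "x = (1\<^sub>m d, v)" by (auto simp: translation_group_eq)
  have "inv\<^bsub>euclidean_group d\<^esub> x = (1\<^sub>m d, - v)"
    using v \<Lambda>.uminus[OF v(1)] by (intro E.inv_equality) (auto simp: orthogonal_group_one)
  then show "inv\<^bsub>euclidean_group d\<^esub> x \<in> translation_group d S"
    using \<Lambda>.uminus[OF v(1)] by (simp add: translation_group_eq)
qed (auto simp: translation_group_eq \<Lambda>.add)

lemma translation_comm:
  "x \<in> translation_group d S \<Longrightarrow> y \<in> translation_group d S \<Longrightarrow>
    x \<otimes>\<^bsub>euclidean_group d\<^esub> y = y \<otimes>\<^bsub>euclidean_group d\<^esub> x"
  by (auto simp: translation_group_eq intro!: comm_add_vec[of _ d])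

lemma translation_torsion_free:
  assumes "x \<in> translation_group d S" "k \<ge> 1"
    "x [^]\<^bsub>euclidean_group d\<^esub> (k::nat) = \<one>\<^bsub>euclidean_group d\<^esub>"
  shows "x = \<one>\<^bsub>euclidean_group d\<^esub>"
proof -
  obtain v where v: "v \<in> \<Lambda>" "x = (1\<^sub>m d, v)" using assms(1) by (auto simp: translation_group_eq)
  have "real k \<cdot>\<^sub>v v = 0\<^sub>v d" using assms(3) v by (simp add: translation_nat_pow)
  then have "v $ i = 0" if "i < d" for i
    using that assms(2) v \<Lambda>.dimD[OF v(1)] by (auto simp: vec_eq_iff)
  then have "v = 0\<^sub>v d" using v by (intro eq_vecI) auto
  then show ?thesis using v by simp
qed

lemma set_pow_translation:
  "set_pow (euclidean_group d) (translation_group d S) n = {(1\<^sub>m d, real n \<cdot>\<^sub>v v) | v. v \<in> \<Lambda>}"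
  by (auto simp: set_pow_def translation_group_eq image_image translation_nat_pow)

text \<open>Discreteness at the identity isolates 0 in \<open>\<Lambda>\<close>, and the independent
  translations give full rank. A lattice basis then provides integer coordinates.\<close>

lemma translation_group_iso:
  assumes "space_group d S"
  shows "eucl_sub d (translation_group d S) \<cong> product_group {..<d} (\<lambda>_. integer_group)"
proof -
  let ?Z = "product_group {..<d} (\<lambda>_. integer_group)"
  obtain B where B: "B \<subseteq> transl_part ` translation_group d S" "finite B" "card B = d"
    "\<not> module.lin_dep class_ring (module_vec TYPE(real) d) B" and disc: "discrete_in d S"
    using assms unfolding space_group_def by blast
  have B\<Lambda>: "B \<subseteq> \<Lambda>" using B(1) by (auto simp: translation_group_eq)
  have "(1\<^sub>m d, 0\<^sub>v d) \<in> S" using \<Lambda>.zero by (simp add: lattice_iff)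
  then obtain \<epsilon> where \<epsilon>: "\<epsilon> > 0"
    and sep: "\<And>h. h \<in> S \<Longrightarrow> eucl_dist d (1\<^sub>m d, 0\<^sub>v d) h < \<epsilon> \<Longrightarrow> h = (1\<^sub>m d, 0\<^sub>v d)"
    using disc unfolding discrete_in_def by blast
  have small: "v = 0\<^sub>v d" if v: "v \<in> \<Lambda>" and le: "(\<Sum>i<d. (v $ i)\<^sup>2) < \<epsilon>\<^sup>2" for v
  proof -
    have "eucl_dist d (1\<^sub>m d, 0\<^sub>v d) (1\<^sub>m d, v) = sqrt (\<Sum>i<d. (v $ i)\<^sup>2)"
      by (simp add: eucl_dist_def)
    also have "\<dots> < \<epsilon>" using le \<epsilon> real_sqrt_less_mono[OF le] by simp
    finally show ?thesis using sep[of "(1\<^sub>m d, v)"] v by (simp add: lattice_iff)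
  qed
  obtain W where W: "W \<in> carrier_mat d d" "det W \<noteq> 0" and \<Lambda>W: "\<Lambda> = {W *\<^sub>v int_vec d z | z. True}"
    using lattice_basis[OF lattice_subgroup \<epsilon> small B\<Lambda> B(2-4)] by blast
  define f :: "(nat \<Rightarrow> int) \<Rightarrow> isometry" where "f z = (1\<^sub>m d, W *\<^sub>v int_vec d z)" for z
  have inj: "inj_on f (carrier ?Z)"
  proof (rule inj_onI)
    fix x y assume x: "x \<in> carrier ?Z" and y: "y \<in> carrier ?Z" and "f x = f y"
    then have "W *\<^sub>v int_vec d x = W *\<^sub>v int_vec d y" by (simp add: f_def)
    then have "W *\<^sub>v (int_vec d x - int_vec d y) = 0\<^sub>v d"
      using W(1) by (subst mult_minus_distrib_mat_vec[of _ d d]) auto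
    then have "int_vec d x - int_vec d y = 0\<^sub>v d"
      using W det_0_iff_vec_prod_zero[OF W(1)] by (metis minus_carrier_vec vec_carrier)
    then have "x i = y i" if "i < d" for i
      using that by (auto simp: vec_eq_iff)
    then show "x = y" using x y by (auto intro: PiE_ext)
  qed
  have img: "f ` carrier ?Z = translation_group d S"
  proof (intro equalityI subsetI)
    fix x assume "x \<in> translation_group d S"
    then obtain z where z: "x = (1\<^sub>m d, W *\<^sub>v int_vec d z)"
      using \<Lambda>W by (auto simp: translation_group_eq)
    \<comment> \<open>Elements of \<open>product_group\<close> are extensional, so the coordinate
      function \<open>z\<close> is cut down to the indices below \<open>d\<close>.\<close>
    have "int_vec d z = int_vec d (\<lambda>i\<in>{..<d}. z i)" by auto
    then have "x = f (\<lambda>i\<in>{..<d}. z i)" using z by (simp add: f_def)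
    then show "x \<in> f ` carrier ?Z" by auto
  qed (use \<Lambda>W in \<open>auto simp: f_def translation_group_eq\<close>)
  have "f \<in> hom ?Z (eucl_sub d (translation_group d S))"
  proof (rule homI)
    fix x y assume "x \<in> carrier ?Z" "y \<in> carrier ?Z"
    have "int_vec d (x \<otimes>\<^bsub>?Z\<^esub> y) = int_vec d x + int_vec d y" by auto
    then show "f (x \<otimes>\<^bsub>?Z\<^esub> y) = f x \<otimes>\<^bsub>eucl_sub d (translation_group d S)\<^esub> f y"
      using W(1) by (simp add: f_def mult_add_distrib_mat_vec[of _ d d])
  qed (use img in auto)
  then have "f \<in> iso ?Z (eucl_sub d (translation_group d S))"
    using inj img by (simp add: iso_def bij_betw_def)
  then show ?thesis using group.iso_sym[of ?Z] by (auto simp: is_iso_def)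
qed

text \<open>Modulo the translations in \<open>n\<Lambda>\<close>, the map \<open>P \<mapsto> (P, \<kappa> P)\<close> is a homomorphism that
  splits \<open>S \<rightarrow> point_group S\<close>.\<close>

lemma subgroup_of_section:
  fixes n :: nat
  assumes \<kappa>: "\<And>P. P \<in> point_group S \<Longrightarrow> (P, \<kappa> P) \<in> S"
    and cocycle: "\<And>P Q. P \<in> point_group S \<Longrightarrow> Q \<in> point_group S \<Longrightarrow>
      \<exists>v\<in>\<Lambda>. \<kappa> P + P *\<^sub>v \<kappa> Q = \<kappa> (P * Q) + real n \<cdot>\<^sub>v v"
    and unit: "\<exists>v\<in>\<Lambda>. \<kappa> (1\<^sub>m d) = real n \<cdot>\<^sub>v v"
    and K: "K = set_pow (euclidean_group d) (translation_group d S) n <#>\<^bsub>euclidean_group d\<^esub>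
      {(P, \<kappa> P) | P. P \<in> point_group S}"
  shows "subgroup K (euclidean_group d)" "K \<subseteq> S"
    "K \<inter> translation_group d S = set_pow (euclidean_group d) (translation_group d S) n"
    "translation_group d S <#>\<^bsub>euclidean_group d\<^esub> K = S"
proof -
  have \<kappa>c: "\<kappa> P \<in> carrier_vec d" if "P \<in> point_group S" for P
    using S_carrier[OF \<kappa>[OF that]] by simp
  \<comment> \<open>A translation multiplied on the left is not twisted by \<open>P\<close>, so
    membership in \<open>K\<close> only says that the translation part is \<open>\<kappa> P\<close>
    modulo \<open>n \<Lambda>\<close>.\<close>
  have K_eq: "K = {(P, \<kappa> P + real n \<cdot>\<^sub>v v) | P v. P \<in> point_group S \<and> v \<in> \<Lambda>}"
  proof -
    have *: "(1\<^sub>m d, real n \<cdot>\<^sub>v v) \<otimes>\<^bsub>euclidean_group d\<^esub> (P, \<kappa> P) = (P, \<kappa> P + real n \<cdot>\<^sub>v v)"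
      if "P \<in> point_group S" "v \<in> \<Lambda>" for P v
      using left_mult_one_mat[OF point_group_carrier[OF that(1)]] \<kappa>c[OF that(1)]
        lattice_carrier[OF that(2)] comm_add_vec[of "\<kappa> P" d "real n \<cdot>\<^sub>v v"] by simp
    have "K = {(1\<^sub>m d, real n \<cdot>\<^sub>v v) \<otimes>\<^bsub>euclidean_group d\<^esub> (P, \<kappa> P) | P v. P \<in> point_group S \<and> v \<in> \<Lambda>}"
      unfolding K set_pow_translation set_mult_def by blast
    also have "\<dots> = {(P, \<kappa> P + real n \<cdot>\<^sub>v v) | P v. P \<in> point_group S \<and> v \<in> \<Lambda>}"
      by (intro Collect_cong ex_cong1) (use * in metis)
    finally show ?thesis .
  qed
  have n\<Lambda>: "real n \<cdot>\<^sub>v v \<in> \<Lambda>" if "v \<in> \<Lambda>" for v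
    using \<Lambda>.smult_int[OF that, of "int n"] by simp
  show KS: "K \<subseteq> S"
  proof
    fix k assume "k \<in> K"
    then obtain P v where k: "k = (P, \<kappa> P + real n \<cdot>\<^sub>v v)" "P \<in> point_group S" "v \<in> \<Lambda>"
      unfolding K_eq by blast
    have "(1\<^sub>m d * P, real n \<cdot>\<^sub>v v + 1\<^sub>m d *\<^sub>v \<kappa> P) \<in> S"
      by (rule S_mult) (use k \<kappa> n\<Lambda> lattice_iff in auto)
    then show "k \<in> S"
      using left_mult_one_mat[OF point_group_carrier[OF k(2)]] \<kappa>c[OF k(2)]
        lattice_carrier[OF k(3)] comm_add_vec[of "\<kappa> P" d "real n \<cdot>\<^sub>v v"] k(1) by simp
  qed
  have mult: "x \<otimes>\<^bsub>euclidean_group d\<^esub> y \<in> K" if x: "x \<in> K" and y: "y \<in> K" for x y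
  proof -
    obtain P v Q w where P: "P \<in> point_group S" "v \<in> \<Lambda>" "x = (P, \<kappa> P + real n \<cdot>\<^sub>v v)"
      and Q: "Q \<in> point_group S" "w \<in> \<Lambda>" "y = (Q, \<kappa> Q + real n \<cdot>\<^sub>v w)"
      using x y unfolding K_eq by blast
    obtain u where u: "u \<in> \<Lambda>" and eq: "\<kappa> P + P *\<^sub>v \<kappa> Q = \<kappa> (P * Q) + real n \<cdot>\<^sub>v u"
      using cocycle P Q by blast
    note c = point_group_carrier[OF P(1)] \<kappa>c[OF P(1)] \<kappa>c[OF Q(1)] \<kappa>c[OF point_group_mult[OF P(1) Q(1)]]
      lattice_carrier[OF P(2)] lattice_carrier[OF Q(2)] lattice_carrier[OF u]
    have "P *\<^sub>v (\<kappa> Q + real n \<cdot>\<^sub>v w) = P *\<^sub>v \<kappa> Q + real n \<cdot>\<^sub>v (P *\<^sub>v w)"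
      using c by (simp add: mult_add_distrib_mat_vec[of _ d d] mult_mat_vec[of _ d d])
    then have "\<kappa> P + real n \<cdot>\<^sub>v v + P *\<^sub>v (\<kappa> Q + real n \<cdot>\<^sub>v w) =
        (\<kappa> P + P *\<^sub>v \<kappa> Q) + real n \<cdot>\<^sub>v (v + P *\<^sub>v w)"
      using c by (intro eq_vecI) (auto simp: algebra_simps)
    also have "\<dots> = \<kappa> (P * Q) + real n \<cdot>\<^sub>v (u + (v + P *\<^sub>v w))"
      unfolding eq using c by (intro eq_vecI) (auto simp: algebra_simps)
    finally have "x \<otimes>\<^bsub>euclidean_group d\<^esub> y = (P * Q, \<kappa> (P * Q) + real n \<cdot>\<^sub>v (u + (v + P *\<^sub>v w)))"
      using P Q by simp
    moreover have "u + (v + P *\<^sub>v w) \<in> \<Lambda>"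
      using u P Q lattice_point_group by (intro \<Lambda>.add) auto
    ultimately show ?thesis using point_group_mult P Q unfolding K_eq by blast
  qed
  obtain u where u: "u \<in> \<Lambda>" "\<kappa> (1\<^sub>m d) = real n \<cdot>\<^sub>v u" using unit by blast
  have nK: "(1\<^sub>m d, real n \<cdot>\<^sub>v v) \<in> K" if v: "v \<in> \<Lambda>" for v
  proof -
    have "real n \<cdot>\<^sub>v v = \<kappa> (1\<^sub>m d) + real n \<cdot>\<^sub>v (v - u)"
      using u v by (intro eq_vecI) (auto simp: algebra_simps)
    then show ?thesis using \<Lambda>.diff[OF v u(1)] point_group_one unfolding K_eq by blast
  qed
  \<comment> \<open>A translation in \<open>K\<close> has linear part \<open>1\<^sub>m d\<close>,
    and \<open>unit\<close> absorbs \<open>\<kappa> (1\<^sub>m d)\<close> into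
    \<open>n \<Lambda>\<close>.\<close>
  have trans: "\<exists>v\<in>\<Lambda>. b = real n \<cdot>\<^sub>v v" if b: "(1\<^sub>m d, b) \<in> K" for b
  proof -
    obtain v where v: "v \<in> \<Lambda>" "b = \<kappa> (1\<^sub>m d) + real n \<cdot>\<^sub>v v"
      using b unfolding K_eq by blast
    have "b = real n \<cdot>\<^sub>v (u + v)" using v u by (simp add: smult_add_distrib_vec[of _ d])
    then show ?thesis using \<Lambda>.add u v by blast
  qed
  show "subgroup K (euclidean_group d)"
  proof (rule E.subgroupI)
    show "K \<subseteq> carrier (euclidean_group d)" using KS subgroup.subset[OF S] by blast
    show "K \<noteq> {}" using nK \<Lambda>.zero by blast
  next
    fix x assume x: "x \<in> K"
    then obtain P v where P: "P \<in> point_group S" "v \<in> \<Lambda>" "x = (P, \<kappa> P + real n \<cdot>\<^sub>v v)"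
      unfolding K_eq by blast
    obtain Q where Q: "Q \<in> point_group S" "Q * P = 1\<^sub>m d" using point_group_inverse[OF P(1)] .
    have "(Q, \<kappa> Q) = (Q, \<kappa> Q + real n \<cdot>\<^sub>v 0\<^sub>v d)" using \<kappa>c[OF Q(1)] by auto
    then have QK: "(Q, \<kappa> Q) \<in> K" using Q \<Lambda>.zero unfolding K_eq by blast
    obtain b where b: "(Q, \<kappa> Q) \<otimes>\<^bsub>euclidean_group d\<^esub> x = (1\<^sub>m d, b)" using P Q by simp
    then have "(1\<^sub>m d, b) \<in> K" using mult[OF QK x] by simp
    then obtain w where w: "w \<in> \<Lambda>" "b = real n \<cdot>\<^sub>v w" using trans by blast
    \<comment> \<open>The element \<open>(Q, \<kappa> Q)\<close> inverts \<open>x\<close> up to the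
      translation by \<open>n w\<close>; cancelling that translation gives a left inverse lying in
      \<open>K\<close>.\<close>
    let ?y = "(1\<^sub>m d, real n \<cdot>\<^sub>v (- w)) \<otimes>\<^bsub>euclidean_group d\<^esub> (Q, \<kappa> Q)"
    have yK: "?y \<in> K" by (rule mult[OF nK[OF \<Lambda>.uminus[OF w(1)]] QK])
    have c: "(1\<^sub>m d, real n \<cdot>\<^sub>v (- w)) \<in> carrier (euclidean_group d)"
        "(Q, \<kappa> Q) \<in> carrier (euclidean_group d)" "x \<in> carrier (euclidean_group d)"
        "?y \<in> carrier (euclidean_group d)"
      using nK[OF \<Lambda>.uminus[OF w(1)]] QK x yK KS subgroup.mem_carrier[OF S] by blast+
    have "?y \<otimes>\<^bsub>euclidean_group d\<^esub> x = (1\<^sub>m d, real n \<cdot>\<^sub>v (- w)) \<otimes>\<^bsub>euclidean_group d\<^esub> (1\<^sub>m d, b)"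
      unfolding b[symmetric] by (rule E.m_assoc[OF c(1-3)])
    also have "\<dots> = \<one>\<^bsub>euclidean_group d\<^esub>"
      using w \<Lambda>.dimD[OF w(1)] by (auto simp: vec_eq_iff)
    finally have "inv\<^bsub>euclidean_group d\<^esub> x = ?y" using c by (intro E.inv_equality)
    then show "inv\<^bsub>euclidean_group d\<^esub> x \<in> K" using yK by simp
  qed (rule mult)
  show "K \<inter> translation_group d S = set_pow (euclidean_group d) (translation_group d S) n"
    unfolding set_pow_translation
  proof (intro equalityI subsetI)
    fix x :: isometry assume "x \<in> K \<inter> translation_group d S"
    then show "x \<in> {(1\<^sub>m d, real n \<cdot>\<^sub>v v) | v. v \<in> \<Lambda>}" using trans by (auto simp: translation_group_eq)
  next
    fix x :: isometry assume "x \<in> {(1\<^sub>m d, real n \<cdot>\<^sub>v v) | v. v \<in> \<Lambda>}"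
    then show "x \<in> K \<inter> translation_group d S" using nK n\<Lambda> by (auto simp: translation_group_eq)
  qed
  show "translation_group d S <#>\<^bsub>euclidean_group d\<^esub> K = S"
  proof (intro equalityI subsetI)
    fix x assume "x \<in> translation_group d S <#>\<^bsub>euclidean_group d\<^esub> K"
    then show "x \<in> S"
      using KS subgroup.m_closed[OF S] by (auto simp: set_mult_def translation_group_def)
  next
    fix x assume x: "x \<in> S"
    obtain P b where Pb: "x = (P, b)" by force
    then have P: "P \<in> point_group S" using x by force
    have l: "b - \<kappa> P \<in> \<Lambda>" using lattice_diff[OF \<kappa>[OF P]] x Pb by simp
    have "(P, \<kappa> P) = (P, \<kappa> P + real n \<cdot>\<^sub>v 0\<^sub>v d)" using \<kappa>c[OF P] by auto
    then have PK: "(P, \<kappa> P) \<in> K" using P \<Lambda>.zero unfolding K_eq by blast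
    have "x = (1\<^sub>m d, b - \<kappa> P) \<otimes>\<^bsub>euclidean_group d\<^esub> (P, \<kappa> P)"
      using Pb x S_carrier[of P b] \<kappa>c[OF P] by auto
    then show "x \<in> translation_group d S <#>\<^bsub>euclidean_group d\<^esub> K"
      using l PK unfolding set_mult_def translation_group_eq by blast
  qed
qed

end

section \<open>The splitting modulo n-th powers of translations\<close>

text \<open>\<open>GREATEST\<close> over the integers is informative only once a maximum is known to
  exist. The admissible coefficients are nonpositive, so their negatives are natural numbers and
  have a least element.\<close>

lemma a_coeff_bezout:
  assumes n: "n \<ge> 1" and coprime: "coprime n (card (point_group S))"
  obtains b :: int where "a_coeff S n * int (card (point_group S)) + b * int n = 1"
proof -
  let ?c = "int (card (point_group S))"
  let ?P = "\<lambda>a::int. a \<le> 0 \<and> (\<exists>b::int. a * ?c + b * int n = 1)"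
  have "gcd ?c (int n) = 1" using coprime by (simp add: coprime_commute)
  then obtain u v where uv: "u * ?c + v * int n = 1" using bezout_int[of ?c "int n"] by metis
  \<comment> \<open>Any Bezout coefficient may be shifted by a multiple of \<open>n\<close>;
    subtracting \<open>\<bar>u\<bar> * int n\<close> makes it nonpositive.\<close>
  have "?P (u - \<bar>u\<bar> * int n)"
  proof
    have "\<bar>u\<bar> * 1 \<le> \<bar>u\<bar> * int n" using n by (intro mult_left_mono) auto
    then show "u - \<bar>u\<bar> * int n \<le> 0" by linarith
    have "(u - \<bar>u\<bar> * int n) * ?c + (v + \<bar>u\<bar> * ?c) * int n = 1"
      using uv by (simp add: algebra_simps)
    then show "\<exists>b. (u - \<bar>u\<bar> * int n) * ?c + b * int n = 1" by blast
  qed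
  then have "\<exists>k::nat. ?P (- int k)"
    by (metis minus_minus neg_0_le_iff_le nonneg_int_cases)
  then have least: "?P (- int (LEAST k. ?P (- int k)))" by (rule LeastI_ex)
  have a_eq: "a_coeff S n = - int (LEAST k. ?P (- int k))"
    unfolding a_coeff_def
  proof (rule Greatest_equality)
    fix a assume a: "?P a"
    then have "?P (- int (nat (- a)))" by simp
    then have "(LEAST k. ?P (- int k)) \<le> nat (- a)" by (rule Least_le)
    then show "a \<le> - int (LEAST k. ?P (- int k))" using a by linarith
  qed (rule least)
  show ?thesis using least that unfolding a_eq by blast
qed

section \<open>The cocycle of \<open>\<tau>\<close> and the corrected section\<close>

context euclidean_subgroup
begin

context
  fixes \<tau> :: "real mat \<Rightarrow> real vec"
  assumes \<tau>: "\<And>P. P \<in> point_group S \<Longrightarrow> (P, \<tau> P) \<in> S"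
begin

text \<open>The cochain whose coboundary is \<open>tau_bar\<close> multiplied by the order of the
  point group.\<close>

abbreviation "tau_sum P \<equiv> finsum_vec TYPE(real) d (tau_bar \<tau> P) (point_group S)"

lemma \<tau>_carrier: "P \<in> point_group S \<Longrightarrow> \<tau> P \<in> carrier_vec d"
  using S_carrier \<tau> by blast

text \<open>The product of \<open>(P, \<tau> P)\<close> and \<open>(Q, \<tau> Q)\<close> has the
  same linear part as \<open>(P * Q, \<tau> (P * Q))\<close>.\<close>

lemma tau_bar_lattice:
  assumes "P \<in> point_group S" "Q \<in> point_group S"
  shows "tau_bar \<tau> P Q \<in> \<Lambda>"
  unfolding tau_bar_def
  using lattice_diff[OF \<tau>[OF point_group_mult[OF assms]] S_mult[OF \<tau>[OF assms(1)] \<tau>[OF assms(2)]]] .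

lemma tau_bar_carrier:
  "P \<in> point_group S \<Longrightarrow> Q \<in> point_group S \<Longrightarrow> tau_bar \<tau> P Q \<in> carrier_vec d"
  using tau_bar_lattice lattice_carrier by blast

text \<open>The 2-cocycle identity. Both sides reduce to
  \<open>\<tau> P + P \<tau> Q + P Q \<tau> R - \<tau> (P Q R)\<close>.\<close>

lemma tau_bar_cocycle:
  assumes P: "P \<in> point_group S" and Q: "Q \<in> point_group S" and R: "R \<in> point_group S"
  shows "tau_bar \<tau> P (Q * R) + P *\<^sub>v tau_bar \<tau> Q R = tau_bar \<tau> (P * Q) R + tau_bar \<tau> P Q"
proof -
  note c = point_group_carrier[OF P] point_group_carrier[OF Q] point_group_carrier[OF R]
  note t = \<tau>_carrier[OF P] \<tau>_carrier[OF Q] \<tau>_carrier[OF R]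
    \<tau>_carrier[OF point_group_mult[OF P Q]] \<tau>_carrier[OF point_group_mult[OF Q R]]
    \<tau>_carrier[OF point_group_mult[OF point_group_mult[OF P Q] R]]
  have e: "P *\<^sub>v tau_bar \<tau> Q R = P *\<^sub>v \<tau> Q + P *\<^sub>v (Q *\<^sub>v \<tau> R) - P *\<^sub>v \<tau> (Q * R)"
    unfolding tau_bar_def using c t
    by (simp add: mult_minus_distrib_mat_vec[of _ d d] mult_add_distrib_mat_vec[of _ d d])
  \<comment> \<open>The matrix-vector products are kept as opaque letters: \<open>b\<close> stands
    for \<open>P \<tau> (Q R)\<close>, which cancels on the left, and \<open>g\<close> for
    \<open>\<tau> (P Q)\<close>, which cancels on the right.\<close>
  have rearrange: "(a + b - x) + (e + f - b) = (g + f - x) + (a + e - g)"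
    if "a \<in> carrier_vec d" "b \<in> carrier_vec d" "e \<in> carrier_vec d" "f \<in> carrier_vec d"
      "g \<in> carrier_vec d" "x \<in> carrier_vec d" for a b e f g x :: "real vec"
    using that by (intro eq_vecI) auto
  have "tau_bar \<tau> (P * Q) R = \<tau> (P * Q) + P *\<^sub>v (Q *\<^sub>v \<tau> R) - \<tau> (P * (Q * R))"
    by (simp add: tau_bar_def assoc_mult_mat_vec[OF c(1,2) t(3)] assoc_mult_mat[OF c])
  moreover have "\<tau> (P * (Q * R)) \<in> carrier_vec d" using t(6) by (simp add: assoc_mult_mat[OF c])
  ultimately show ?thesis
    unfolding e by (simp only: tau_bar_def) (rule rearrange; use c t in auto)
qed

text \<open>Left multiplication has a left inverse, and on a finite set injectivity implies
  surjectivity. This justifies replacing \<open>R\<close> by \<open>Q * R\<close> in sums over the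
  point group.\<close>

lemma bij_betw_point_group_mult:
  assumes fin: "finite (point_group S)" and Q: "Q \<in> point_group S"
  shows "bij_betw ((*) Q) (point_group S) (point_group S)"
proof -
  obtain Q' where Q': "Q' \<in> point_group S" "Q' * Q = 1\<^sub>m d" using point_group_inverse[OF Q] .
  have "inj_on ((*) Q) (point_group S)"
  proof (rule inj_on_inverseI)
    fix R assume "R \<in> point_group S"
    then show "Q' * (Q * R) = R"
      using Q' Q point_group_carrier by (metis assoc_mult_mat left_mult_one_mat)
  qed
  moreover have "(*) Q ` point_group S \<subseteq> point_group S" using point_group_mult Q by blast
  ultimately show ?thesis using endo_inj_surj[OF fin] by (auto simp: bij_betw_def)
qed

text \<open>If the point group is infinite, both the sum and the cardinality are 0 by convention, so
  the two identities hold in that case too.\<close>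

lemma finsum_vec_infinite: "infinite X \<Longrightarrow> finsum_vec TYPE(real) d f X = 0\<^sub>v d"
  unfolding finsum_vec_def
  by (simp add: comm_monoid.finprod_infinite[OF comm_monoid_vec] monoid_vec_simps)

lemma tau_sum_carrier: "P \<in> point_group S \<Longrightarrow> tau_sum P \<in> carrier_vec d"
  using tau_bar_carrier by (intro finsum_vec_closed) auto

text \<open>Sum \<open>tau_bar_cocycle\<close> over \<open>R\<close>. Replacing \<open>Q * R\<close>
  by \<open>R\<close> in the first term gives \<open>tau_sum P\<close>, while
  \<open>tau_bar \<tau> P Q\<close> does not depend on \<open>R\<close> and is counted once for each
  element.\<close>

lemma tau_sum_cocycle:
  assumes P: "P \<in> point_group S" and Q: "Q \<in> point_group S"
  shows "tau_sum P + P *\<^sub>v tau_sum Q =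
    tau_sum (P * Q) + real (card (point_group S)) \<cdot>\<^sub>v tau_bar \<tau> P Q"
proof (cases "finite (point_group S)")
  case False
  then show ?thesis
    using point_group_carrier[OF P] tau_bar_carrier[OF P Q] by (auto simp: finsum_vec_infinite)
next
  case True
  let ?L = "point_group S"
  note PQ = point_group_mult[OF P Q]
  note c = point_group_carrier[OF P]
  show ?thesis
  proof (rule eq_vecI)
    fix i assume "i < dim_vec (tau_sum (P * Q) + real (card ?L) \<cdot>\<^sub>v tau_bar \<tau> P Q)"
    then have i: "i < d" using tau_bar_carrier[OF P Q] by simp
    have idx: "tau_sum R $ j = (\<Sum>X\<in>?L. tau_bar \<tau> R X $ j)" if "R \<in> ?L" "j < d" for R j
      using index_finsum_vec[OF True that(2)] tau_bar_carrier[OF that(1)] by auto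
    have mv: "(P *\<^sub>v v) $ i = (\<Sum>j<d. P $$ (i, j) * v $ j)" if "v \<in> carrier_vec d" for v
      using c that i by (simp add: scalar_prod_def lessThan_atLeast0)
    \<comment> \<open>Linearity of \<open>P\<close> over the sum, obtained by exchanging the sum
      over the point group with the sum over matrix columns.\<close>
    have "(P *\<^sub>v tau_sum Q) $ i = (\<Sum>j<d. P $$ (i, j) * (\<Sum>R\<in>?L. tau_bar \<tau> Q R $ j))"
      using mv[OF tau_sum_carrier[OF Q]] idx[OF Q] by simp
    also have "\<dots> = (\<Sum>R\<in>?L. \<Sum>j<d. P $$ (i, j) * tau_bar \<tau> Q R $ j)"
      unfolding sum_distrib_left by (rule sum.swap)
    also have "\<dots> = (\<Sum>R\<in>?L. (P *\<^sub>v tau_bar \<tau> Q R) $ i)"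
      using mv tau_bar_carrier[OF Q] by (intro sum.cong) auto
    finally have 1: "(P *\<^sub>v tau_sum Q) $ i = (\<Sum>R\<in>?L. (P *\<^sub>v tau_bar \<tau> Q R) $ i)" .
    have 2: "tau_sum P $ i = (\<Sum>R\<in>?L. tau_bar \<tau> P (Q * R) $ i)"
      using idx[OF P i] sum.reindex_bij_betw[OF bij_betw_point_group_mult[OF True Q], of "\<lambda>R. tau_bar \<tau> P R $ i"]
      by simp
    have "(tau_sum P + P *\<^sub>v tau_sum Q) $ i = tau_sum P $ i + (P *\<^sub>v tau_sum Q) $ i"
      using i c by simp
    also have "\<dots> = (\<Sum>R\<in>?L. tau_bar \<tau> P (Q * R) $ i + (P *\<^sub>v tau_bar \<tau> Q R) $ i)"
      unfolding 1 2 by (simp add: sum.distrib)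
    also have "\<dots> = (\<Sum>R\<in>?L. tau_bar \<tau> (P * Q) R $ i + tau_bar \<tau> P Q $ i)"
    proof (rule sum.cong[OF refl])
      fix R assume R: "R \<in> ?L"
      have "(tau_bar \<tau> P (Q * R) + P *\<^sub>v tau_bar \<tau> Q R) $ i = (tau_bar \<tau> (P * Q) R + tau_bar \<tau> P Q) $ i"
        unfolding tau_bar_cocycle[OF P Q R] ..
      then show "tau_bar \<tau> P (Q * R) $ i + (P *\<^sub>v tau_bar \<tau> Q R) $ i = tau_bar \<tau> (P * Q) R $ i + tau_bar \<tau> P Q $ i"
        using i c tau_bar_carrier[OF P Q] by simp
    qed
    also have "\<dots> = tau_sum (P * Q) $ i + real (card ?L) * tau_bar \<tau> P Q $ i"
      using idx[OF PQ i] by (simp add: sum.distrib)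
    finally show "(tau_sum P + P *\<^sub>v tau_sum Q) $ i =
        (tau_sum (P * Q) + real (card ?L) \<cdot>\<^sub>v tau_bar \<tau> P Q) $ i"
      using i tau_bar_carrier[OF P Q] by simp
  qed (use c tau_bar_carrier[OF P Q] in simp)
qed

text \<open>For \<open>P = 1\<^sub>m d\<close> every summand equals
  \<open>\<tau> (1\<^sub>m d)\<close>. This vector need not vanish, as \<open>\<tau>\<close> is not
  assumed to be normalized.\<close>

lemma tau_sum_one: "tau_sum (1\<^sub>m d) = real (card (point_group S)) \<cdot>\<^sub>v \<tau> (1\<^sub>m d)"
proof (cases "finite (point_group S)")
  case False
  then show ?thesis using \<tau>_carrier[OF point_group_one] by (auto simp: finsum_vec_infinite)
next
  case True
  have tb: "tau_bar \<tau> (1\<^sub>m d) Q = \<tau> (1\<^sub>m d)" if "Q \<in> point_group S" for Q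
    using \<tau>_carrier[OF that] \<tau>_carrier[OF point_group_one] left_mult_one_mat[OF point_group_carrier[OF that]]
    by (auto simp: tau_bar_def)
  show ?thesis
  proof (rule eq_vecI)
    fix i assume "i < dim_vec (real (card (point_group S)) \<cdot>\<^sub>v \<tau> (1\<^sub>m d))"
    then have i: "i < d" using \<tau>_carrier[OF point_group_one] by simp
    have "tau_sum (1\<^sub>m d) $ i = (\<Sum>Q\<in>point_group S. tau_bar \<tau> (1\<^sub>m d) Q $ i)"
      using index_finsum_vec[OF True i] tau_bar_carrier[OF point_group_one] by auto
    then show "tau_sum (1\<^sub>m d) $ i = (real (card (point_group S)) \<cdot>\<^sub>v \<tau> (1\<^sub>m d)) $ i"
      using tb i \<tau>_carrier[OF point_group_one] by simp
  qed (use tau_sum_carrier[OF point_group_one] \<tau>_carrier[OF point_group_one] in simp)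
qed

text \<open>Subtracting \<open>a\<close> times \<open>tau_sum\<close> from \<open>\<tau>\<close>
  replaces the cocycle by \<open>(1 - a c) tau_bar\<close>, where \<open>c\<close> is the order of
  the point group. By the Bezout relation this is \<open>n b tau_bar\<close>, a multiple of
  \<open>n\<close> in the lattice.\<close>

lemma P_S_section:
  assumes n: "n \<ge> 1" and coprime: "coprime n (card (point_group S))"
    and PS: "P_S d S \<tau> n \<subseteq> S"
    and K: "K = set_pow (euclidean_group d) (translation_group d S) n <#>\<^bsub>euclidean_group d\<^esub> P_S d S \<tau> n"
  shows "subgroup K (euclidean_group d)" "K \<subseteq> S"
    "K \<inter> translation_group d S = set_pow (euclidean_group d) (translation_group d S) n"
    "translation_group d S <#>\<^bsub>euclidean_group d\<^esub> K = S"
proof -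
  obtain b where ab: "a_coeff S n * int (card (point_group S)) + b * int n = 1"
    using a_coeff_bezout[OF n coprime] .
  define a c where "a = real_of_int (a_coeff S n)" and "c = real (card (point_group S))"
  have ab': "1 - a * c = real n * real_of_int b"
    using arg_cong[OF ab, of real_of_int] by (simp add: a_def c_def algebra_simps)
  define \<kappa> where "\<kappa> P = \<tau> P - a \<cdot>\<^sub>v tau_sum P" for P
  have PS_eq: "P_S d S \<tau> n = {(P, \<kappa> P) | P. P \<in> point_group S}"
    by (simp add: P_S_def \<kappa>_def a_def)
  have 1: "(P, \<kappa> P) \<in> S" if "P \<in> point_group S" for P
    using PS that unfolding PS_eq by blast
  have 2: "\<exists>v\<in>\<Lambda>. \<kappa> P + P *\<^sub>v \<kappa> Q = \<kappa> (P * Q) + real n \<cdot>\<^sub>v v"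
    if P: "P \<in> point_group S" and Q: "Q \<in> point_group S" for P Q
  proof
    note pc = point_group_carrier[OF P] and PQ = point_group_mult[OF P Q]
    note t = \<tau>_carrier[OF P] \<tau>_carrier[OF Q] \<tau>_carrier[OF PQ]
      tau_sum_carrier[OF P] tau_sum_carrier[OF Q] tau_sum_carrier[OF PQ] tau_bar_carrier[OF P Q]
    show "real_of_int b \<cdot>\<^sub>v tau_bar \<tau> P Q \<in> \<Lambda>" by (rule \<Lambda>.smult_int[OF tau_bar_lattice[OF P Q]])
    show "\<kappa> P + P *\<^sub>v \<kappa> Q = \<kappa> (P * Q) + real n \<cdot>\<^sub>v (real_of_int b \<cdot>\<^sub>v tau_bar \<tau> P Q)"
    proof (rule eq_vecI)
      fix i assume "i < dim_vec (\<kappa> (P * Q) + real n \<cdot>\<^sub>v (real_of_int b \<cdot>\<^sub>v tau_bar \<tau> P Q))"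
      then have i: "i < d" using t by simp
      have "P *\<^sub>v \<kappa> Q = P *\<^sub>v \<tau> Q - a \<cdot>\<^sub>v (P *\<^sub>v tau_sum Q)"
        unfolding \<kappa>_def using pc t by (simp add: mult_minus_distrib_mat_vec[of _ d d] mult_mat_vec[of _ d d])
      then have e0: "(\<kappa> P + P *\<^sub>v \<kappa> Q) $ i =
          \<tau> P $ i - a * tau_sum P $ i + ((P *\<^sub>v \<tau> Q) $ i - a * (P *\<^sub>v tau_sum Q) $ i)"
        using i t pc by (simp add: \<kappa>_def del: index_mult_mat_vec)
      have e1: "tau_sum P $ i + (P *\<^sub>v tau_sum Q) $ i = tau_sum (P * Q) $ i + c * tau_bar \<tau> P Q $ i"
        using arg_cong[OF tau_sum_cocycle[OF P Q], of "\<lambda>v. v $ i"] i t pc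
        by (simp add: c_def del: index_mult_mat_vec)
      have e2: "\<tau> P $ i + (P *\<^sub>v \<tau> Q) $ i = \<tau> (P * Q) $ i + tau_bar \<tau> P Q $ i"
        using i t pc by (simp add: tau_bar_def del: index_mult_mat_vec)
      have "(\<kappa> P + P *\<^sub>v \<kappa> Q) $ i = (\<tau> P $ i + (P *\<^sub>v \<tau> Q) $ i) - a * (tau_sum P $ i + (P *\<^sub>v tau_sum Q) $ i)"
        unfolding e0 by (simp add: algebra_simps)
      also have "\<dots> = \<tau> (P * Q) $ i - a * tau_sum (P * Q) $ i + (1 - a * c) * tau_bar \<tau> P Q $ i"
        unfolding e1 e2 by (simp add: algebra_simps)
      also have "\<dots> = (\<kappa> (P * Q) + real n \<cdot>\<^sub>v (real_of_int b \<cdot>\<^sub>v tau_bar \<tau> P Q)) $ i"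
        unfolding ab' using i t by (simp add: \<kappa>_def)
      finally show "(\<kappa> P + P *\<^sub>v \<kappa> Q) $ i =
          (\<kappa> (P * Q) + real n \<cdot>\<^sub>v (real_of_int b \<cdot>\<^sub>v tau_bar \<tau> P Q)) $ i" .
    qed (use pc t in \<open>simp add: \<kappa>_def\<close>)
  qed
  have 3: "\<exists>v\<in>\<Lambda>. \<kappa> (1\<^sub>m d) = real n \<cdot>\<^sub>v v"
  proof
    have "\<tau> (1\<^sub>m d) \<in> \<Lambda>" using \<tau>[OF point_group_one] by (simp add: lattice_iff)
    then show "real_of_int b \<cdot>\<^sub>v \<tau> (1\<^sub>m d) \<in> \<Lambda>" by (rule \<Lambda>.smult_int)
    \<comment> \<open>At the identity, \<open>tau_sum\<close> is \<open>c\<close> times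
      \<open>\<tau>\<close>, so the factor \<open>1 - a c\<close> appears here as well.\<close>
    have "\<kappa> (1\<^sub>m d) = (1 - a * c) \<cdot>\<^sub>v \<tau> (1\<^sub>m d)"
      unfolding \<kappa>_def tau_sum_one using \<tau>_carrier[OF point_group_one]
      by (intro eq_vecI) (auto simp: c_def algebra_simps)
    then show "\<kappa> (1\<^sub>m d) = real n \<cdot>\<^sub>v (real_of_int b \<cdot>\<^sub>v \<tau> (1\<^sub>m d))"
      unfolding ab' by (simp add: smult_smult_assoc)
  qed
  show "subgroup K (euclidean_group d)" "K \<subseteq> S"
    "K \<inter> translation_group d S = set_pow (euclidean_group d) (translation_group d S) n"
    "translation_group d S <#>\<^bsub>euclidean_group d\<^esub> K = S"
    using subgroup_of_section[OF 1 2 3 K[unfolded PS_eq]] by blast+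
qed

end

end

text \<open>The normality and subgroup conjuncts certify that the quotients in the last two
  conjuncts are quotients of groups by normal subgroups.\<close>

theorem theorem6p7:
  fixes d d1 d2 m n N :: nat
    and S G F T P :: "isometry set"
    and \<tau> :: "real mat \<Rightarrow> real vec"
  assumes "d \<ge> 1" and "d = d1 + d2"
    and "space_group d2 S"
    and "subgroup G (euclidean_group d)" and "discrete_in d G"
    and "G \<subseteq> orth_dsum d1 S" and "proj d1 d2 ` G = S"
    and "F = kernel (eucl_sub d G) (eucl_sub d2 S) (proj d1 d2)"
    and "T \<subseteq> G" and "bij_betw (proj d1 d2) T (translation_group d2 S)"
    and "\<forall>A \<in> point_group S. (A, \<tau> A) \<in> S"
    and "m \<in> M0_set d G T"
    and "n \<ge> 1" and "coprime n m" and "coprime n (card (point_group S))"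
    and "P \<subseteq> G" and "bij_betw (proj d1 d2) P (P_S d2 S \<tau> n)"
    and "N = n * m"
  shows
    "let E = euclidean_group d;
         Tm = set_pow E T m;
         TN = set_pow E T N;
         H = set_pow E T n <#>\<^bsub>E\<^esub> F <#>\<^bsub>E\<^esub> P
     in TN \<lhd> eucl_sub d G \<and> TN \<lhd> eucl_sub d Tm \<and>
        subgroup H (eucl_sub d G) \<and> TN \<lhd> eucl_sub d H \<and>
        internal_semidirect_product (eucl_sub d G Mod TN)
          (carrier (eucl_sub d Tm Mod TN)) (carrier (eucl_sub d H Mod TN)) \<and>
        (eucl_sub d Tm Mod TN) \<cong> product_group {..<d2} (\<lambda>_. integer_mod_group n)"
proof -
  define A where "A = translation_group d2 S"
  define K where "K = set_pow (euclidean_group d2) A n <#>\<^bsub>euclidean_group d2\<^esub> P_S d2 S \<tau> n"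
  define H where "H = set_pow (euclidean_group d) T n <#>\<^bsub>euclidean_group d\<^esub> F <#>\<^bsub>euclidean_group d\<^esub> P"
  have S: "subgroup S (euclidean_group d2)" using assms(3) by (simp add: space_group_def)
  interpret S: euclidean_subgroup d2 S by (rule euclidean_subgroup.intro[OF S])
  have AS: "A \<subseteq> S" by (auto simp: A_def translation_group_def)
  \<comment> \<open>Membership of \<open>m\<close> in \<open>M0_set d G T\<close> supplies both
    \<open>m \<ge> 1\<close> and the normality of the m-th powers.\<close>
  interpret torsion_free_lift "eucl_sub d G" "eucl_sub d2 S" "proj d1 d2" A T m n
  proof (intro torsion_free_lift.intro torsion_free_lift_axioms.intro)
    show "group_hom (eucl_sub d G) (eucl_sub d2 S) (proj d1 d2)"
      unfolding assms(2) by (rule group_hom_proj[OF assms(4)[unfolded assms(2)] S assms(6)])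
    show "subgroup A (eucl_sub d2 S)"
      using S.E.subgroup_incl[OF S.translation_subgroup S] AS by (simp add: A_def)
    show "x = \<one>\<^bsub>eucl_sub d2 S\<^esub>"
      if "x \<in> A" "k \<ge> 1" "x [^]\<^bsub>eucl_sub d2 S\<^esub> k = \<one>\<^bsub>eucl_sub d2 S\<^esub>" for x and k :: nat
      using S.translation_torsion_free[of x k] that
      by (simp add: A_def flip: S.E.nat_pow_consistent)
  qed (use assms S.translation_comm in \<open>auto simp: A_def M0_set_def\<close>)
  have PS: "proj d1 d2 ` P = P_S d2 S \<tau> n" using assms(17) by (simp add: bij_betw_def)
  \<comment> \<open>The inclusion comes from the lift: \<open>P_S\<close> is the projection of
    \<open>P\<close>, which lies in \<open>G\<close>, and \<open>G\<close> projects onto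
    \<open>S\<close>.\<close>
  then have PSS: "P_S d2 S \<tau> n \<subseteq> S" using assms(7,16) by blast
  have \<tau>: "(P, \<tau> P) \<in> S" if "P \<in> point_group S" for P using assms(11) that by blast
  note K = S.P_S_section[OF \<tau> assms(13,15) PSS K_def[unfolded A_def]]
  have HG: "subgroup H (eucl_sub d G)" and TNH: "TN \<subseteq> H"
    and semi: "internal_semidirect_product (eucl_sub d G Mod TN)
      (carrier (eucl_sub d Tm Mod TN)) (carrier (eucl_sub d H Mod TN))"
    using semidirect_product_of_lift[of P "P_S d2 S \<tau> n" K H]
      S.E.subgroup_incl[OF K(1) S K(2)] K(3,4) PS assms(8,14,16)
    by (simp_all add: K_def H_def A_def)
  have iso: "(eucl_sub d Tm Mod TN) \<cong> product_group {..<d2} (\<lambda>_. integer_mod_group n)"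
    using Tm_Mod_TN_iso[of "{..<d2}"] S.translation_group_iso[OF assms(3)] by (simp add: A_def)
  have "TN \<lhd> eucl_sub d Tm" "TN \<lhd> eucl_sub d H"
    using G.normal_restrict_supergroup[OF Tm_subgroup TN_normal TN_subset]
      G.normal_restrict_supergroup[OF HG TN_normal TNH] by simp_all
  then show ?thesis
    using TN_normal HG semi iso unfolding Let_def H_def assms(18) by simp
qed

end
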